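(* Let ${\bf a},{\bf b}\in(2\mathbb N)^p$ and ${\bf c},{\bf d}\in(2\mathbb N)^q$, and let $n\ge\max(2,p+q)$ be an integer. Then $$\Phi_n\begin{pmatrix}{\bf a}&{\bf c}\\ {\bf b}&{\bf d}\end{pmatrix}=\Phi_n\begin{pmatrix}{\bf a}&{\bf d}\\ {\bf b}&{\bf c}\end{pmatrix}.$$
   Context: Double factorial convention: for an integer $m\ge0$, $m!!=(m-1)(m-3)\cdots$, the product of the positive integers $\le m-1$ of the parity of $m-1$ (empty product $=1$). For a $2\times q$ matrix with nonnegative integer entries and $n\ge\max(2,q)$, $I_n\begin{pmatrix}{\bf a}\\{\bf b}\end{pmatrix}=\int_{O_n}\prod_j u_{1j}^{a_j}u_{2j}^{b_j}\,du$ (Haar probability measure on $O_n$) and $\Phi_n\begin{pmatrix}{\bf a}\\ {\bf b}\end{pmatrix}=\frac{(\Sigma a_i+n-2)!!\,(\Sigma b_i+n-2)!!}{(n-2)!!^2\,\prod a_i!!\,\prod b_i!!}\,I_n\begin{pmatrix}{\bf a}\\ {\bf b}\end{pmatrix}$. *)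

theory Defs
  imports "HOL-Analysis.Analysis" "HOL-Probability.Probability"
begin

text \<open>Double factorial in the paper's convention: m!! = (m-1)(m-3)..., empty product 1.\<close>
fun dfact :: "nat \<Rightarrow> nat" where
  "dfact 0 = 1"
| "dfact (Suc 0) = 1"
| "dfact (Suc (Suc m)) = Suc m * dfact m"

definition haar_On :: "(real^'n^'n) measure \<Rightarrow> bool" where
  "haar_On M \<longleftrightarrow> prob_space M \<and> sets M = sets borel
     \<and> emeasure M {U. orthogonal_matrix U} = 1
     \<and> (\<forall>Q. orthogonal_matrix Q \<longrightarrow> distr M M (\<lambda>U. Q ** U) = M)"

definition catv :: "nat \<Rightarrow> (nat \<Rightarrow> nat) \<Rightarrow> (nat \<Rightarrow> nat) \<Rightarrow> nat \<Rightarrow> nat" where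
  "catv p a c j = (if j < p then a j else c (j - p))"

text \<open>I_n of a 2 x q exponent matrix (rows a, b); e enumerates the index type,
  so the entry u_{ij} (1-based) is U $ e (i-1) $ e (j-1).\<close>
definition I_On :: "(real^'n^'n) measure \<Rightarrow> (nat \<Rightarrow> 'n) \<Rightarrow> nat \<Rightarrow> (nat \<Rightarrow> nat) \<Rightarrow> (nat \<Rightarrow> nat) \<Rightarrow> real" where
  "I_On M e q a b = (\<integral>U. (\<Prod>j<q. (U $ e 0 $ e j) ^ a j * (U $ e 1 $ e j) ^ b j) \<partial>M)"

definition Phi_On :: "(real^'n^'n) measure \<Rightarrow> (nat \<Rightarrow> 'n) \<Rightarrow> nat \<Rightarrow> (nat \<Rightarrow> nat) \<Rightarrow> (nat \<Rightarrow> nat) \<Rightarrow> real" where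
  "Phi_On M e q a b =
     real (dfact ((\<Sum>j<q. a j) + CARD('n) - 2)) * real (dfact ((\<Sum>j<q. b j) + CARD('n) - 2))
     / (real (dfact (CARD('n) - 2)) ^ 2 * (\<Prod>j<q. real (dfact (a j))) * (\<Prod>j<q. real (dfact (b j))))
     * I_On M e q a b"

end

theory Submission
  imports Defs "HOL-Computational_Algebra.Polynomial"
begin

text \<open>
  Write \<open>i = e 0\<close> and let \<open>v\<close> be a row of a Haar orthogonal matrix. After multiplication by the
  normalising constants, which are moments of the norm of a Gaussian vector in dimension \<open>n - 1\<close>,
  the integral over two rows becomes the expectation of
  \<open>\<Prod>j. (s * x j) ^ a j * (y j + \<i> * c * x j) ^ b j\<close>, where \<open>x\<close>, \<open>y\<close> are independent standard
  Gaussian vectors, \<open>c = v i\<close> and \<open>s\<^sup>2 = 1 - c\<^sup>2\<close>. For fixed \<open>v\<close> this factorises over the columns.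
  The complex Gaussians \<open>X = s * x j\<close> and \<open>Y = y j + \<i> * c * x j\<close> have equal variances
  \<open>E X\<^sup>2 = s\<^sup>2 = 1 - c\<^sup>2 = E Y\<^sup>2\<close>, so \<open>E (X ^ a * Y ^ b)\<close> is symmetric in \<open>a\<close> and \<open>b\<close>, and the two
  exponents may be exchanged in each column separately.

  The second row is brought into this form as follows. Given the first row \<open>u\<close>, the second one is
  uniform on the unit sphere of the orthogonal complement of \<open>u\<close>, so its moments are those of a
  Gaussian vector on that complement up to a radial factor; and adding \<open>(t + \<i> * g) * u\<close> with
  independent standard Gaussians \<open>t\<close>, \<open>g\<close> changes no moment, which turns this vector into
  \<open>y + \<i> * g * u\<close> with \<open>y\<close> standard Gaussian on the whole space. The radial factor of the first row
  and \<open>g\<close> combine to a Gaussian vector in dimension \<open>n\<close>, whose direction is \<open>v\<close> and whose norm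
  turns \<open>u\<close> into \<open>x\<close>.
\<close>

subsection \<open>Functions of polynomial growth\<close>

text \<open>Measurability and a growth bound are bundled so that one set of structural closure rules
  settles both the integrability and the Fubini side conditions of all later integrals of polynomial
  expressions.\<close>

definition polygrowth :: "('a::euclidean_space \<Rightarrow> 'b::real_normed_vector) \<Rightarrow> bool" where
  "polygrowth f \<longleftrightarrow> f \<in> borel_measurable borel \<and> (\<exists>C k. \<forall>x. norm (f x) \<le> C * (1 + norm x) ^ k)"

lemma polygrowth_measurable [measurable_dest]: "polygrowth f \<Longrightarrow> f \<in> borel_measurable borel"
  by (simp add: polygrowth_def)

lemma polygrowthE:
  assumes "polygrowth f"
  obtains C k where "C \<ge> 0" "\<And>x. norm (f x) \<le> C * (1 + norm x) ^ k"
proof -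
  obtain C k where C: "\<And>x. norm (f x) \<le> C * (1 + norm x) ^ k"
    using assms by (auto simp: polygrowth_def)
  have "norm (f x) \<le> \<bar>C\<bar> * (1 + norm x) ^ k" for x
    by (rule order_trans[OF C]) (intro mult_right_mono, auto)
  then show ?thesis using that[of "\<bar>C\<bar>" k] by auto
qed

lemma polygrowthI:
  assumes "f \<in> borel_measurable borel" "\<And>x. norm (f x) \<le> C * (1 + norm x) ^ k"
  shows "polygrowth f"
  using assms by (auto simp: polygrowth_def)

lemma polygrowth_bounded_linear:
  assumes "bounded_linear f"
  shows "polygrowth f"
proof -
  obtain K where K: "K \<ge> 0" "\<And>x. norm (f x) \<le> norm x * K"
    using bounded_linear.nonneg_bounded[OF assms] by blast
  have "norm (f x) \<le> K * (1 + norm x) ^ 1" for x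
    using K(2)[of x] K(1) by (simp add: algebra_simps)
  moreover have "f \<in> borel_measurable borel"
    by (intro borel_measurable_continuous_onI linear_continuous_on assms)
  ultimately show ?thesis by (rule polygrowthI[rotated])
qed

lemma polygrowth_ident: "polygrowth (\<lambda>x. x)"
  by (rule polygrowth_bounded_linear[OF bounded_linear_ident])

lemma polygrowth_const: "polygrowth (\<lambda>x. c)"
  by (rule polygrowthI[where C = "norm c" and k = 0]) auto

lemma polygrowth_compose:
  assumes "polygrowth f" "polygrowth g"
  shows "polygrowth (\<lambda>x. f (g x))"
proof -
  obtain C k where f: "C \<ge> 0" "\<And>x. norm (f x) \<le> C * (1 + norm x) ^ k"
    using polygrowthE[OF assms(1)] by metis
  obtain D l where g: "D \<ge> 0" "\<And>x. norm (g x) \<le> D * (1 + norm x) ^ l"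
    using polygrowthE[OF assms(2)] by metis
  have "norm (f (g x)) \<le> C * (1 + D) ^ k * (1 + norm x) ^ (l * k)" for x
  proof -
    have "norm (f (g x)) \<le> C * (1 + norm (g x)) ^ k" by (rule f)
    also have "\<dots> \<le> C * ((1 + D) * (1 + norm x) ^ l) ^ k"
    proof (intro mult_left_mono power_mono)
      have "(1 + norm x) ^ l \<ge> 1" by (simp add: one_le_power)
      then show "1 + norm (g x) \<le> (1 + D) * (1 + norm x) ^ l"
        using g(2)[of x] by (simp only: distrib_right mult_1_left add_mono)
    qed (use f in auto)
    finally show ?thesis by (simp add: power_mult_distrib power_mult mult.assoc)
  qed
  moreover have "(\<lambda>x. f (g x)) \<in> borel_measurable borel"
    by (rule measurable_compose[OF polygrowth_measurable[OF assms(2)]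
        polygrowth_measurable[OF assms(1)]])
  ultimately show ?thesis by (rule polygrowthI[rotated])
qed

lemma polygrowth_add:
  fixes f g :: "'a::euclidean_space \<Rightarrow> 'b::{real_normed_vector, second_countable_topology}"
  assumes "polygrowth f" "polygrowth g"
  shows "polygrowth (\<lambda>x. f x + g x)"
proof -
  obtain C k where f: "C \<ge> 0" "\<And>x. norm (f x) \<le> C * (1 + norm x) ^ k"
    using polygrowthE[OF assms(1)] by metis
  obtain D l where g: "D \<ge> 0" "\<And>x. norm (g x) \<le> D * (1 + norm x) ^ l"
    using polygrowthE[OF assms(2)] by metis
  have "norm (f x + g x) \<le> (C + D) * (1 + norm x) ^ (k + l)" for x
  proof -
    have "norm (f x + g x) \<le> C * (1 + norm x) ^ k + D * (1 + norm x) ^ l"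
      by (rule order_trans[OF norm_triangle_ineq add_mono]) (rule f g)+
    also have "\<dots> \<le> C * (1 + norm x) ^ (k + l) + D * (1 + norm x) ^ (k + l)"
      using f g by (intro add_mono mult_left_mono power_increasing) auto
    finally show ?thesis by (simp add: algebra_simps)
  qed
  moreover have "(\<lambda>x. f x + g x) \<in> borel_measurable borel"
    using assms by measurable
  ultimately show ?thesis by (rule polygrowthI[rotated])
qed

lemma polygrowth_Pair:
  fixes f :: "'a::euclidean_space \<Rightarrow> 'b::euclidean_space" and g :: "'a \<Rightarrow> 'c::euclidean_space"
  assumes "polygrowth f" "polygrowth g"
  shows "polygrowth (\<lambda>x. (f x, g x))"
proof -
  have "polygrowth (\<lambda>v::'b. (v, 0::'c))" "polygrowth (\<lambda>w::'c. (0::'b, w))"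
    by (intro
        polygrowth_bounded_linear bounded_linear_Pair bounded_linear_ident bounded_linear_zero)+
  then have "polygrowth (\<lambda>x. (f x, 0) + (0, g x))"
    by (intro polygrowth_add polygrowth_compose[OF _ assms(1)] polygrowth_compose[OF _ assms(2)])
  then show ?thesis by simp
qed

lemma polygrowth_mult:
  fixes f g :: "'a::euclidean_space \<Rightarrow> 'b::{real_normed_algebra, second_countable_topology}"
  assumes "polygrowth f" "polygrowth g"
  shows "polygrowth (\<lambda>x. f x * g x)"
proof -
  obtain C k where f: "C \<ge> 0" "\<And>x. norm (f x) \<le> C * (1 + norm x) ^ k"
    using polygrowthE[OF assms(1)] by metis
  obtain D l where g: "D \<ge> 0" "\<And>x. norm (g x) \<le> D * (1 + norm x) ^ l"
    using polygrowthE[OF assms(2)] by metis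
  have "norm (f x * g x) \<le> (C * D) * (1 + norm x) ^ (k + l)" for x
  proof -
    have "norm (f x * g x) \<le> (C * (1 + norm x) ^ k) * (D * (1 + norm x) ^ l)"
      by (rule order_trans[OF norm_mult_ineq]) (intro mult_mono f g; use f in simp)
    then show ?thesis by (simp add: power_add mult_ac)
  qed
  moreover have "(\<lambda>x. f x * g x) \<in> borel_measurable borel"
    using assms by measurable
  ultimately show ?thesis by (rule polygrowthI[rotated])
qed

lemma polygrowth_norm: "polygrowth f \<Longrightarrow> polygrowth (\<lambda>x. norm (f x))"
  by (auto simp: polygrowth_def intro: borel_measurable_norm)

lemma polygrowth_of_real:
  "polygrowth f \<Longrightarrow> polygrowth (\<lambda>x. of_real (f x) :: 'b::{real_normed_algebra_1, second_countable_topology})"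
  by (rule polygrowth_compose[OF polygrowth_bounded_linear[OF bounded_linear_of_real]])

lemma polygrowth_scaleR:
  fixes g :: "'a::euclidean_space \<Rightarrow> 'b::euclidean_space"
  assumes "polygrowth f" "polygrowth g"
  shows "polygrowth (\<lambda>x. f x *\<^sub>R g x)"
proof -
  obtain C k where f: "C \<ge> 0" "\<And>x. norm (f x) \<le> C * (1 + norm x) ^ k"
    using polygrowthE[OF assms(1)] by metis
  obtain D l where g: "D \<ge> 0" "\<And>x. norm (g x) \<le> D * (1 + norm x) ^ l"
    using polygrowthE[OF assms(2)] by metis
  have "norm (f x *\<^sub>R g x) \<le> (C * D) * (1 + norm x) ^ (k + l)" for x
  proof -
    have "norm (f x *\<^sub>R g x) \<le> (C * (1 + norm x) ^ k) * (D * (1 + norm x) ^ l)"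
      unfolding norm_scaleR by (intro mult_mono g; use f in simp)
    then show ?thesis by (simp add: power_add mult_ac)
  qed
  moreover have "(\<lambda>x. f x *\<^sub>R g x) \<in> borel_measurable borel"
    using assms by measurable
  ultimately show ?thesis by (rule polygrowthI[rotated])
qed

lemma polygrowth_sum:
  fixes f :: "'i \<Rightarrow> 'a::euclidean_space \<Rightarrow> 'b::{real_normed_vector, second_countable_topology}"
  shows "(\<And>i. i \<in> I \<Longrightarrow> polygrowth (f i)) \<Longrightarrow> polygrowth (\<lambda>x. \<Sum>i\<in>I. f i x)"
  by (induction I rule: infinite_finite_induct) (auto intro: polygrowth_const polygrowth_add)

lemma polygrowth_prod:
  fixes f :: "'i \<Rightarrow> 'a::euclidean_space \<Rightarrow> 'b::{real_normed_field, second_countable_topology}"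
  shows "(\<And>i. i \<in> I \<Longrightarrow> polygrowth (f i)) \<Longrightarrow> polygrowth (\<lambda>x. \<Prod>i\<in>I. f i x)"
  by (induction I rule: infinite_finite_induct) (auto intro: polygrowth_const polygrowth_mult)

lemma polygrowth_power:
  fixes f :: "'a::euclidean_space \<Rightarrow> 'b::{real_normed_field, second_countable_topology}"
  shows "polygrowth f \<Longrightarrow> polygrowth (\<lambda>x. f x ^ k)"
  by (induction k) (auto intro: polygrowth_const polygrowth_mult)

lemma polygrowth_vec_nth:
  fixes f :: "'a::euclidean_space \<Rightarrow> 'b::euclidean_space ^ 'n"
  assumes "polygrowth f"
  shows "polygrowth (\<lambda>x. f x $ i)"
  by (rule polygrowth_compose[where f = "\<lambda>v. v $ i", OF
      polygrowth_bounded_linear[OF bounded_linear_vec_nth] assms])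

lemma polygrowth_minus:
  fixes f g :: "'a::euclidean_space \<Rightarrow> 'b::{real_normed_vector, second_countable_topology}"
  assumes "polygrowth f" "polygrowth g"
  shows "polygrowth (\<lambda>x. f x - g x)"
proof -
  have "polygrowth (\<lambda>x. - g x)" using assms(2) by (auto simp: polygrowth_def)
  from polygrowth_add[OF assms(1) this] show ?thesis by simp
qed

lemmas polygrowth_intros = polygrowth_const polygrowth_ident polygrowth_add polygrowth_minus
  polygrowth_mult polygrowth_power polygrowth_sum polygrowth_prod polygrowth_norm polygrowth_of_real
  polygrowth_scaleR polygrowth_vec_nth polygrowth_bounded_linear[OF bounded_linear_fst]
  polygrowth_compose[OF polygrowth_bounded_linear[OF bounded_linear_fst]]
  polygrowth_bounded_linear[OF bounded_linear_snd]
  polygrowth_compose[OF polygrowth_bounded_linear[OF bounded_linear_snd]]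

lemma polygrowth_poly:
  fixes f :: "'a::euclidean_space \<Rightarrow> 'b::{real_normed_field, second_countable_topology}"
  shows "polygrowth f \<Longrightarrow> polygrowth (\<lambda>x. poly p (f x))"
  by (simp add: poly_altdef polygrowth_intros)

lemma polygrowth_vecI:
  fixes f :: "'a::euclidean_space \<Rightarrow> real^'n"
  assumes "\<And>i. polygrowth (\<lambda>x. f x $ i)"
  shows "polygrowth f"
proof -
  have "f = (\<lambda>x. \<Sum>i\<in>UNIV. f x $ i *\<^sub>R axis i 1)"
    by (simp add: fun_eq_iff vec_eq_iff axis_def if_distrib cong: if_cong)
  moreover have "polygrowth (\<lambda>x. \<Sum>i\<in>UNIV. f x $ i *\<^sub>R (axis i 1 :: real^'n))"
    by (intro polygrowth_intros assms)
  ultimately show ?thesis by simp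
qed

lemma polygrowth_transpose_mult:
  fixes A :: "'a::euclidean_space \<Rightarrow> real^'n^'n" and f :: "'a \<Rightarrow> real^'n"
  assumes "polygrowth A" "polygrowth f"
  shows "polygrowth (\<lambda>x. transpose (A x) *v f x)"
  by (rule polygrowth_vecI) (simp add: matrix_vector_mult_def transpose_def polygrowth_intros assms)

subsection \<open>Measures with finite moments\<close>

text \<open>Both the Gaussian and the Haar measures satisfy this, so integrability and exchange of
  integrals can be proved once for all of them.\<close>

definition all_moments :: "'a::euclidean_space measure \<Rightarrow> bool" where
  "all_moments N \<longleftrightarrow> prob_space N \<and> sets N = sets borel \<and> (\<forall>k. integrable N (\<lambda>x. norm x ^ k))"

lemma all_momentsD:
  assumes "all_moments N"
  shows "prob_space N" "sets N = sets borel"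
  using assms by (auto simp: all_moments_def)

text \<open>The binomial expansion of \<open>(1 + norm x) ^ k\<close> bounds the integrand by
  finitely many moments.\<close>

lemma polygrowth_integrable:
  fixes f :: "'a::euclidean_space \<Rightarrow> 'b::{banach, second_countable_topology}"
  assumes N: "all_moments N" and f: "polygrowth f"
  shows "integrable N f"
proof -
  obtain C k where C: "C \<ge> 0" "\<And>x. norm (f x) \<le> C * (1 + norm x) ^ k"
    using polygrowthE[OF f] by metis
  have "integrable N (\<lambda>x. C * (\<Sum>i\<le>k. of_nat (k choose i) * norm x ^ i))"
    using N by (intro integrable_mult_right Bochner_Integration.integrable_sum) (auto simp:
        all_moments_def)
  then have *: "integrable N (\<lambda>x. C * (1 + norm x) ^ k)"
    by (simp add: add.commute[of 1] binomial_ring)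
  have "f \<in> borel_measurable N"
    using f all_momentsD[OF N] by (auto simp: polygrowth_def cong: measurable_cong_sets)
  then show ?thesis
    using C by (intro Bochner_Integration.integrable_bound[OF *])
        (auto intro!: AE_I2 order_trans[OF C(2)])
qed

text \<open>For Euclidean spaces the product of the Borel sigma algebras is the Borel sigma algebra
  of the product, so growth in the pair yields the measurability needed for product
  measures.\<close>

lemma borel_pair_measurable:
  fixes F :: "'a::euclidean_space \<Rightarrow> 'b::euclidean_space \<Rightarrow> 'c::real_normed_vector"
  assumes "sets N1 = sets borel" "sets N2 = sets borel" "polygrowth (\<lambda>p. F (fst p) (snd p))"
  shows "case_prod F \<in> borel_measurable (N1 \<Otimes>\<^sub>M N2)"
proof -
  have "sets (N1 \<Otimes>\<^sub>M N2) = sets (borel :: ('a \<times> 'b) measure)"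
    using sets_pair_measure_cong[OF assms(1,2)] by (simp only: borel_prod)
  then show ?thesis
    using polygrowth_measurable[OF assms(3)]
    by (simp add: case_prod_beta' cong: measurable_cong_sets)
qed

lemma polygrowth_fix_fst:
  fixes F :: "'a::euclidean_space \<Rightarrow> 'b::euclidean_space \<Rightarrow> 'c::real_normed_vector"
  assumes F: "polygrowth (\<lambda>p. F (fst p) (snd p))"
  shows "polygrowth (F x)"
  using polygrowth_compose[OF F polygrowth_Pair[OF polygrowth_const
      polygrowth_bounded_linear[OF bounded_linear_ident]], of x] by simp

text \<open>The estimate \<open>1 + norm (x, y) \<le> (1 + norm x) * (1 + norm y)\<close> separates
  the variables, and the factor in \<open>y\<close> integrates to a finite constant. Iterated
  integrals thus stay within the class.\<close>

lemma polygrowth_integral: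
  fixes F :: "'a::euclidean_space \<Rightarrow> 'b::euclidean_space \<Rightarrow> 'c::{banach, second_countable_topology}"
  assumes N: "all_moments N" and F: "polygrowth (\<lambda>p. F (fst p) (snd p))"
  shows "polygrowth (\<lambda>x. \<integral>y. F x y \<partial>N)"
proof -
  interpret prob_space N using N by (rule all_momentsD)
  obtain C k where C: "C \<ge> 0" "\<And>p. norm (F (fst p) (snd p)) \<le> C * (1 + norm p) ^ k"
    using polygrowthE[OF F] by metis
  have bound: "norm (F x y) \<le> C * ((1 + norm x) ^ k * (1 + norm y) ^ k)" for x y
  proof -
    have "norm (F x y) \<le> C * (1 + norm (x, y)) ^ k" using C(2)[of "(x, y)"] by simp
    also have "\<dots> \<le> C * ((1 + norm x) * (1 + norm y)) ^ k"
    proof (intro mult_left_mono power_mono C)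
      have "1 + norm (x, y) \<le> 1 + (norm x + norm y)"
        by (simp add: norm_Pair_le)
      also have "\<dots> \<le> (1 + norm x) * (1 + norm y)" by (simp add: algebra_simps)
      finally show "1 + norm (x, y) \<le> (1 + norm x) * (1 + norm y)" .
    qed simp
    finally show ?thesis by (simp add: power_mult_distrib)
  qed
  have int: "integrable N (\<lambda>y. (1 + norm y) ^ k)"
    by (intro polygrowth_integrable[OF N] polygrowth_power polygrowth_add polygrowth_const
        polygrowth_norm polygrowth_bounded_linear bounded_linear_ident)
  have "norm (\<integral>y. F x y \<partial>N) \<le> (C * (\<integral>y. (1 + norm y) ^ k \<partial>N)) * (1 + norm x) ^ k" for x
  proof -
    have "norm (\<integral>y. F x y \<partial>N) \<le> (\<integral>y. C * ((1 + norm x) ^ k * (1 + norm y) ^ k) \<partial>N)"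
      by (intro Bochner_Integration.integral_norm_bound_integral polygrowth_integrable[OF N]
          polygrowth_fix_fst[OF F] bound integrable_mult_right int)
    then show ?thesis by (simp add: mult_ac)
  qed
  moreover have "(\<lambda>x. \<integral>y. F x y \<partial>N) \<in> borel_measurable borel"
    by (intro borel_measurable_lebesgue_integral borel_pair_measurable F all_momentsD N refl)
  ultimately show ?thesis by (rule polygrowthI[rotated])
qed

lemma polygrowth_integrable_pair:
  fixes F :: "'a::euclidean_space \<Rightarrow> 'b::euclidean_space \<Rightarrow> 'c::{banach, second_countable_topology}"
  assumes N1: "all_moments N1" and N2: "all_moments N2" and F: "polygrowth (\<lambda>p. F (fst p) (snd p))"
  shows "integrable (N1 \<Otimes>\<^sub>M N2) (case_prod F)"
proof -
  interpret N1: prob_space N1 using N1 by (rule all_momentsD)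
  interpret N2: prob_space N2 using N2 by (rule all_momentsD)
  interpret pair_sigma_finite N1 N2 ..
  show ?thesis
  proof (rule Fubini_integrable)
    show "case_prod F \<in> borel_measurable (N1 \<Otimes>\<^sub>M N2)"
      by (intro borel_pair_measurable F all_momentsD N1 N2)
    show "integrable N1 (\<lambda>x. \<integral>y. norm (case (x, y) of (x, y) \<Rightarrow> F x y) \<partial>N2)"
      by (simp, intro polygrowth_integrable[OF N1] polygrowth_integral N2 polygrowth_norm F)
    show "AE x in N1. integrable N2 (\<lambda>y. case (x, y) of (x, y) \<Rightarrow> F x y)"
      by (simp add: polygrowth_integrable[OF N2] polygrowth_fix_fst[OF F])
  qed
qed

lemma polygrowth_Fubini:
  fixes F :: "'a::euclidean_space \<Rightarrow> 'b::euclidean_space \<Rightarrow> 'c::{banach, second_countable_topology}"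
  assumes N1: "all_moments N1" and N2: "all_moments N2" and F: "polygrowth (\<lambda>p. F (fst p) (snd p))"
  shows "(\<integral>x. \<integral>y. F x y \<partial>N2 \<partial>N1) = (\<integral>y. \<integral>x. F x y \<partial>N1 \<partial>N2)"
proof -
  interpret N1: prob_space N1 using N1 by (rule all_momentsD)
  interpret N2: prob_space N2 using N2 by (rule all_momentsD)
  interpret pair_sigma_finite N1 N2 ..
  show ?thesis
    using Fubini_integral[OF polygrowth_integrable_pair[OF assms]] by simp
qed

subsection \<open>The standard Gaussian measure\<close>

text \<open>Writing the density through the norm makes its rotation invariance visible;
  \<open>gauss_altdef\<close> supplies the product form over coordinates.\<close>

definition gauss :: "'a::euclidean_space measure" where
  "gauss = density lborel (\<lambda>x. ennreal ((1 / sqrt (2 * pi)) ^ DIM('a) * exp (- (norm x)\<^sup>2 / 2)))"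

lemma sets_gauss [simp, measurable_cong]: "sets gauss = sets borel"
  by (simp add: gauss_def)

lemma space_gauss [simp]: "space gauss = UNIV"
  by (simp add: gauss_def)

lemma gauss_altdef:
  "gauss = density lborel (\<lambda>x::'a::euclidean_space. ennreal (\<Prod>b\<in>Basis. std_normal_density (x \<bullet> b)))"
proof -
  have "(1 / sqrt (2 * pi)) ^ DIM('a) * exp (- (norm x)\<^sup>2 / 2)
      = (\<Prod>b\<in>Basis. std_normal_density (x \<bullet> b))" for x :: 'a
  proof -
    have "(norm x)\<^sup>2 = (\<Sum>b\<in>Basis. (x \<bullet> b)\<^sup>2)"
      by (simp add: norm_eq_sqrt_inner euclidean_inner[of x x] power2_eq_square sum_nonneg)
    then show ?thesis
      by (simp add: std_normal_density_def prod_dividef sum_negf sum_divide_distrib power_one_over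
          flip: exp_sum)
  qed
  then show ?thesis unfolding gauss_def by simp
qed

lemma gauss_real: "gauss = density lborel (\<lambda>x::real. ennreal (std_normal_density x))"
  by (simp add: gauss_def std_normal_density_def)

text \<open>Since \<open>norm x ^ k\<close> is at most the product of
  \<open>(1 + \<bar>x \<bullet> b\<bar>) ^ k\<close> over the basis, its integral is bounded by a
  product of finite one-dimensional Gaussian integrals.\<close>

lemma all_moments_gauss: "all_moments (gauss :: 'a::euclidean_space measure)"
proof -
  have fin: "(\<integral>\<^sup>+x. ennreal (std_normal_density x * (1 + \<bar>x\<bar>) ^ k) \<partial>lborel) < \<infinity>" for k
  proof -
    have *: "integrable lborel (\<lambda>x. std_normal_density x * \<bar>x\<bar> ^ i)" for i
      by (rule integrable_std_normal_moment_abs)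
    have "integrable lborel (\<lambda>x. \<Sum>i\<le>k. of_nat (k choose i) * (std_normal_density x * \<bar>x\<bar> ^ i))"
      by (intro integrable_mult_right Bochner_Integration.integrable_sum *)
    then have "integrable lborel (\<lambda>x. std_normal_density x * (1 + \<bar>x\<bar>) ^ k)"
      by (simp add: add.commute[of 1] binomial_ring sum_distrib_left mult_ac)
    then show ?thesis
      by (subst (asm) integrable_iff_bounded) (simp add: abs_mult)
  qed
  have prob: "prob_space (gauss :: 'a measure)"
  proof
    have "(\<integral>\<^sup>+x. ennreal (std_normal_density x) \<partial>lborel) = 1"
      using prob_space.emeasure_space_1[OF prob_space_normal_density[of 1 0]]
      by (simp add: emeasure_density)
    then show "emeasure (gauss :: 'a measure) (space gauss) = 1"
      by (simp add: gauss_altdef emeasure_density prod_ennreal[symmetric]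
          nn_integral_lborel_prod[where f = "\<lambda>_ x. ennreal (std_normal_density x)"])
  qed
  have "integrable (gauss :: 'a measure) (\<lambda>x. norm x ^ k)" for k
  proof (rule integrableI_bounded)
    have "ennreal ((\<Prod>b\<in>Basis. std_normal_density (x \<bullet> b)) * norm x ^ k)
       \<le> (\<Prod>b\<in>Basis. ennreal (std_normal_density (x \<bullet> b) * (1 + \<bar>x \<bullet> b\<bar>) ^ k))" for x :: 'a
    proof -
      have "norm x \<le> (\<Sum>b\<in>Basis. \<bar>x \<bullet> b\<bar>)" by (rule norm_le_l1)
      also have "\<dots> \<le> (\<Prod>b\<in>Basis. (1 + \<bar>x \<bullet> b\<bar>))"
        by (rule sum_le_prod) simp
      finally have "norm x ^ k \<le> (\<Prod>b\<in>Basis. (1 + \<bar>x \<bullet> b\<bar>)) ^ k"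
        by (simp add: power_mono)
      then show ?thesis
        by (subst prod_ennreal)
            (auto intro!: ennreal_leI mult_left_mono prod_nonneg simp: prod.distrib prod_power_distrib)
    qed
    then have "(\<integral>\<^sup>+x. ennreal (norm (norm x ^ k)) \<partial>(gauss :: 'a measure)) \<le>
      (\<integral>\<^sup>+x. (\<Prod>b\<in>Basis. ennreal (std_normal_density ((x::'a) \<bullet> b) * (1 + \<bar>x \<bullet> b\<bar>) ^ k)) \<partial>lborel)"
      by (simp add: gauss_altdef nn_integral_density ennreal_mult'[symmetric] prod_nonneg
          nn_integral_mono)
    also have "\<dots> < \<infinity>"
      using fin by (subst nn_integral_lborel_prod) (auto simp: power_less_top_ennreal)
    finally show "(\<integral>\<^sup>+x. ennreal (norm (norm x ^ k)) \<partial>(gauss :: 'a measure)) < \<infinity>" .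
  qed simp
  with prob show ?thesis by (simp add: all_moments_def)
qed

section \<open>Rotation invariance of Lebesgue and Gaussian measure\<close>

lemma nn_integral_lborel_translate:
  fixes g :: "'a::euclidean_space \<Rightarrow> ennreal"
  assumes [measurable]: "g \<in> borel_measurable borel"
  shows "(\<integral>\<^sup>+x. g (c + x) \<partial>lborel) = (\<integral>\<^sup>+x. g x \<partial>lborel)"
  by (subst (2) lborel_distr_plus[of c, symmetric]) (simp add: nn_integral_distr)

text \<open>Uniqueness of translation-invariant measures: weight by the rotation-invariant Gaussian density
  and apply Fubini, so that no determinant is needed.\<close>
lemma nn_integral_lborel_orthogonal:
  fixes g :: "'a::euclidean_space \<Rightarrow> ennreal" and T :: "'a \<Rightarrow> 'a"
  assumes T: "orthogonal_transformation T" and [measurable]: "g \<in> borel_measurable borel"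
  shows "(\<integral>\<^sup>+x. g (T x) \<partial>lborel) = (\<integral>\<^sup>+x. g x \<partial>lborel)"
proof -
  define f :: "'a \<Rightarrow> ennreal"
      where "f x = ennreal ((1 / sqrt (2 * pi)) ^ DIM('a) * exp (- (norm x)\<^sup>2 / 2))" for x
  have [measurable]: "f \<in> borel_measurable borel" "T \<in> borel_measurable borel"
    unfolding f_def
    using T by (auto intro!: borel_measurable_continuous_onI linear_continuous_on
        simp: orthogonal_transformation_linear linear_conv_bounded_linear[symmetric])
  have Z: "(\<integral>\<^sup>+x. f x \<partial>lborel) = 1"
    using prob_space.emeasure_space_1[OF all_momentsD(1)[OF all_moments_gauss[where 'a = 'a]]]
    by (simp add: gauss_def emeasure_density f_def)
  have lin: "linear T" and [simp]: "\<And>x. norm (T x) = norm x"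
    using T by (auto simp: orthogonal_transformation)
  have surj: "\<exists>w. T w = x" for x
    using orthogonal_transformation_surj[OF T] by (metis surjD)
  have "(\<integral>\<^sup>+y. g (T y) \<partial>lborel) = (\<integral>\<^sup>+x. f x * (\<integral>\<^sup>+y. g (T y) \<partial>lborel) \<partial>lborel)"
    by (simp add: nn_integral_multc Z)
  also have "\<dots> = (\<integral>\<^sup>+x. (\<integral>\<^sup>+y. f x * g (x + T y) \<partial>lborel) \<partial>lborel)"
  proof (rule nn_integral_cong)
    fix x
    obtain w where w: "T w = x" using surj by blast
    have "(\<integral>\<^sup>+y. g (T y) \<partial>lborel) = (\<integral>\<^sup>+y. g (T (w + y)) \<partial>lborel)"
      by (rule nn_integral_lborel_translate[symmetric]) simp
    then show "f x * (\<integral>\<^sup>+y. g (T y) \<partial>lborel) = (\<integral>\<^sup>+y. f x * g (x + T y) \<partial>lborel)"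
      by (simp add: linear_add[OF lin] w nn_integral_cmult)
  qed
  also have "\<dots> = (\<integral>\<^sup>+y. (\<integral>\<^sup>+x. f x * g (x + T y) \<partial>lborel) \<partial>lborel)"
    by (rule lborel_pair.Fubini') simp
  also have "\<dots> = (\<integral>\<^sup>+y. (\<integral>\<^sup>+x. f (x - T y) * g x \<partial>lborel) \<partial>lborel)"
  proof (rule nn_integral_cong)
    fix y
    show "(\<integral>\<^sup>+x. f x * g (x + T y) \<partial>lborel) = (\<integral>\<^sup>+x. f (x - T y) * g x \<partial>lborel)"
      using nn_integral_lborel_translate[of "\<lambda>x. f (x - T y) * g x" "T y"] by
          (simp add: add.commute)
  qed
  also have "\<dots> = (\<integral>\<^sup>+x. (\<integral>\<^sup>+y. f (x - T y) * g x \<partial>lborel) \<partial>lborel)"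
    by (rule lborel_pair.Fubini') simp
  also have "\<dots> = (\<integral>\<^sup>+x. g x \<partial>lborel)"
  proof (rule nn_integral_cong)
    fix x
    obtain w where w: "T w = x" using surj by blast
    \<comment> \<open>With \<open>x = T w\<close> and \<open>T\<close> norm preserving, the weight
      depends on \<open>w - y\<close> only, so its integral over \<open>y\<close> is the total mass
      1.\<close>
    have "f (x - T y) = f (- w + y)" for y
    proof -
      have "norm (x - T y) = norm (w - y)"
        by (simp add: w[symmetric] linear_diff[OF lin, symmetric])
      then show ?thesis by (simp add: f_def norm_minus_commute)
    qed
    then show "(\<integral>\<^sup>+y. f (x - T y) * g x \<partial>lborel) = g x"
      using nn_integral_lborel_translate[of f "- w"] by (simp add: nn_integral_multc Z)
  qed
  finally show ?thesis .
qed

text \<open>The density depends on the norm alone, and Lebesgue measure is invariant under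
  orthogonal maps.\<close>

lemma gauss_orthogonal:
  fixes f :: "'a::euclidean_space \<Rightarrow> 'b::{banach, second_countable_topology}" and T :: "'a \<Rightarrow> 'a"
  assumes T: "orthogonal_transformation T" and [measurable]: "f \<in> borel_measurable borel"
  shows "(\<integral>x. f (T x) \<partial>gauss) = (\<integral>x. f x \<partial>gauss)"
proof -
  have [measurable]: "T \<in> borel_measurable borel"
    using T by (auto intro!: borel_measurable_continuous_onI linear_continuous_on
        simp: orthogonal_transformation_linear linear_conv_bounded_linear[symmetric])
  have "distr gauss borel T = (gauss :: 'a measure)"
  proof (rule measure_eqI)
    fix A assume "A \<in> sets (distr gauss borel T)"
    then have [measurable]: "A \<in> sets borel" by simp
    let ?d = "\<lambda>x::'a. ennreal ((1 / sqrt (2 * pi)) ^ DIM('a) * exp (- (norm x)\<^sup>2 / 2))"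
    have A: "T -` A \<in> sets borel" using measurable_sets_borel[of T borel A] by simp
    have "emeasure (distr gauss borel T) A = (\<integral>\<^sup>+x. ?d x * indicator A (T x) \<partial>lborel)"
      using A by (simp add: emeasure_distr gauss_def emeasure_density indicator_def)
    also have "\<dots> = (\<integral>\<^sup>+x. ?d (T x) * indicator A (T x) \<partial>lborel)"
      using T by (simp add: orthogonal_transformation)
    also have "\<dots> = (\<integral>\<^sup>+x. ?d x * indicator A x \<partial>lborel)"
      by (rule nn_integral_lborel_orthogonal[OF T]) simp
    also have "\<dots> = emeasure gauss A"
      by (simp add: gauss_def emeasure_density)
    finally show "emeasure (distr gauss borel T) A = emeasure gauss A" .
  qed simp
  then show ?thesis
    using integral_distr[of T gauss borel f] by simp
qed

text \<open>Squared norms add on a product space, so the exponential densities multiply.\<close>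

lemma gauss_pair: "gauss \<Otimes>\<^sub>M gauss = (gauss :: ('a::euclidean_space \<times> 'b::euclidean_space) measure)"
proof -
  have "sigma_finite_measure (gauss :: 'b measure)"
    by (intro prob_space_imp_sigma_finite all_momentsD all_moments_gauss)
  then show ?thesis
    unfolding gauss_def
    by (subst pair_measure_density)
       (auto simp: lborel_prod gauss_def[symmetric] case_prod_beta' norm_prod_def power_add ennreal_mult'[symmetric] lborel.sigma_finite_measure_axioms mult_exp_exp
          algebra_simps add_divide_distrib intro!: arg_cong2[where f = density] ext)
qed

lemma measure_gauss_UNIV [simp]: "measure gauss (UNIV :: 'a::euclidean_space set) = 1"
  using prob_space.prob_space[OF all_momentsD(1)[OF all_moments_gauss[where 'a = 'a]]] by simp

lemma integral_gauss_pair: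
  fixes F :: "'a::euclidean_space \<times> 'b::euclidean_space \<Rightarrow> 'c::{banach, second_countable_topology}"
  assumes "polygrowth F"
  shows "(\<integral>p. F p \<partial>gauss) = (\<integral>x. \<integral>y. F (x, y) \<partial>gauss \<partial>gauss)"
proof -
  interpret N1: prob_space "gauss :: 'a measure" by (rule all_momentsD[OF all_moments_gauss])
  interpret N2: prob_space "gauss :: 'b measure" by (rule all_momentsD[OF all_moments_gauss])
  interpret pair_sigma_finite "gauss :: 'a measure" "gauss :: 'b measure" ..
  show ?thesis
    using assms by (subst integral_fst') (simp_all add: gauss_pair polygrowth_integrable
        all_moments_gauss)
qed

section \<open>Replacing one coordinate of a Gaussian vector\<close>

text \<open>The formula is linear in \<open>(x, t)\<close>, which lets the growth rules apply
  directly. For \<open>t = 0\<close> it is the orthogonal projection onto the hyperplane where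
  coordinate \<open>k\<close> vanishes.\<close>

definition vec_upd :: "'n \<Rightarrow> real^'n \<Rightarrow> real \<Rightarrow> real^'n" where
  "vec_upd k x t = x + (t - x $ k) *\<^sub>R axis k 1"

lemma vec_upd_nth [simp]: "vec_upd k x t $ i = (if i = k then t else x $ i)"
  by (simp add: vec_upd_def axis_def)

lemma norm_vec_upd: "(norm (vec_upd k x t))\<^sup>2 = (norm x)\<^sup>2 - (x $ k)\<^sup>2 + t\<^sup>2"
  for x :: "real^'n"
proof -
  have "(norm y)\<^sup>2 = (y $ k)\<^sup>2 + (\<Sum>i\<in>UNIV - {k}. (y $ i)\<^sup>2)" for y :: "real^'n"
    by (simp add: norm_vec_def L2_set_def sum_nonneg sum.remove[of _ k])
  then show ?thesis by simp
qed

lemma polygrowth_vec_upd: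
  fixes f :: "'a::euclidean_space \<Rightarrow> real^'n"
  assumes "polygrowth f" "polygrowth g"
  shows "polygrowth (\<lambda>x. vec_upd k (f x) (g x))"
  unfolding vec_upd_def by (intro polygrowth_intros assms)

text \<open>Exchanging the coordinate \<open>k\<close> of \<open>x\<close> with \<open>t\<close> is an orthogonal transformation of the pair \<open>(x, t)\<close>.\<close>
lemma integral_gauss_resample:
  fixes F :: "real^'n \<Rightarrow> 'c::{banach, second_countable_topology}"
  assumes F: "polygrowth F"
  shows "(\<integral>x. F x \<partial>gauss) = (\<integral>x. \<integral>t. F (vec_upd k x t) \<partial>gauss \<partial>gauss)"
proof -
  define T :: "(real^'n) \<times> real \<Rightarrow> (real^'n) \<times> real" where "T p
      = (vec_upd k (fst p) (snd p), fst p $ k)" for p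
  have T: "orthogonal_transformation T"
    unfolding orthogonal_transformation
  proof (intro conjI allI)
    show "linear T"
      by (rule linearI) (auto simp: T_def vec_eq_iff algebra_simps)
    fix v :: "(real^'n) \<times> real"
    have "(norm (T v))\<^sup>2 = (norm v)\<^sup>2"
      by (cases v) (simp add: T_def norm_Pair norm_vec_upd)
    then show "norm (T v) = norm v" by simp
  qed
  have fst: "polygrowth (\<lambda>p :: (real^'n) \<times> real. F (fst p))"
    by (rule polygrowth_compose[OF F polygrowth_bounded_linear[OF bounded_linear_fst]])
  have "bounded_linear T"
    using T by (simp add: orthogonal_transformation_linear linear_conv_bounded_linear[symmetric])
  then have fstT: "polygrowth (\<lambda>p. F (fst (T p)))"
    by (rule polygrowth_compose[OF fst polygrowth_bounded_linear])
  have "(\<integral>x. F x \<partial>gauss) = (\<integral>x. \<integral>t. F (fst (x, t :: real)) \<partial>gauss \<partial>gauss)"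
    by simp
  also have "\<dots> = (\<integral>p. F (fst (p :: _ \<times> real)) \<partial>gauss)"
    by (rule integral_gauss_pair[OF fst, symmetric])
  also have "\<dots> = (\<integral>p. F (fst (T p)) \<partial>gauss)"
    by (rule gauss_orthogonal[OF T polygrowth_measurable[OF fst], symmetric])
  also have "\<dots> = (\<integral>x. \<integral>t. F (vec_upd k x t) \<partial>gauss \<partial>gauss)"
    by (subst integral_gauss_pair[OF fstT]) (simp add: T_def)
  finally show ?thesis .
qed

text \<open>Independence of the coordinates: resampling coordinate \<open>k\<close> leaves the
  factors of the other indices untouched, so its integral splits off in the induction.\<close>

lemma integral_gauss_prod:
  fixes h :: "'n::finite \<Rightarrow> real \<Rightarrow> 'c::{real_normed_field, banach, second_countable_topology}"
  assumes h: "\<And>i. i \<in> S \<Longrightarrow> polygrowth (h i)"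
  shows "(\<integral>x. (\<Prod>i\<in>S. h i (x $ i)) \<partial>(gauss :: (real^'n) measure)) = (\<Prod>i\<in>S. \<integral>t. h i t \<partial>gauss)"
proof -
  have "finite S" by simp
  then show ?thesis using h
  proof (induction S rule: finite_induct)
    case empty
    show ?case by simp
  next
    case (insert k S)
    have eq: "(\<Prod>i\<in>insert k S. h i (vec_upd k x t $ i)) = h k t * (\<Prod>i\<in>S. h i (x $ i))" for x t
      using insert.hyps by (auto intro!: arg_cong2[where f = "(*)"] prod.cong)
    have pg: "polygrowth (\<lambda>x. \<Prod>i\<in>insert k S. h i (x $ i))"
      by (intro polygrowth_prod polygrowth_compose[OF insert.prems] polygrowth_vec_nth
          polygrowth_ident)
    have "(\<integral>x. (\<Prod>i\<in>insert k S. h i (x $ i)) \<partial>(gauss :: (real^'n) measure))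
        = (\<integral>x. \<integral>t. h k t * (\<Prod>i\<in>S. h i (x $ i)) \<partial>gauss \<partial>gauss)"
      unfolding integral_gauss_resample[OF pg, of k] eq ..
    also have "\<dots> = (\<integral>t. h k t \<partial>gauss) * (\<Prod>i\<in>S. \<integral>t. h i t \<partial>gauss)"
      using insert by simp
    finally show ?case using insert.hyps by simp
  qed
qed

subsection \<open>Gaussian moments\<close>

lemma gauss_moment_Suc: "(\<integral>x. x ^ Suc k \<partial>gauss) = real k * (\<integral>x. x ^ (k - 1) \<partial>gauss)"
proof -
  have eq: "(\<integral>x. x ^ j \<partial>gauss) = (\<integral>x. std_normal_density x * x ^ j \<partial>lborel)" for j
    by (simp add: gauss_real integral_density)
  show ?thesis
  proof (cases "even k")
    case True
    have odd: "(\<integral>x. (x::real) ^ j \<partial>gauss) = 0" if "odd j" for j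
      using that integral_std_normal_moment_odd[of "j div 2"] by (simp add: eq)
    \<comment> \<open>For \<open>k = 0\<close> the truncated exponent \<open>k - 1\<close> is even,
      but the factor \<open>k\<close> then vanishes.\<close>
    have "k = 0 \<or> odd (k - 1)" using True by auto
    then show ?thesis using odd[of "Suc k"] odd[of "k - 1"] True by auto
  next
    case False
    then obtain j where k: "k = 2 * j + 1" by (auto elim: oddE)
    have "(fact (2 * Suc j) :: real) = 2 * (real j + 1) * ((2 * real j + 1) * fact (2 * j))"
      by (simp add: algebra_simps)
    then have "fact (2 * Suc j) / (2 ^ Suc j * fact (Suc j)) = (2 * real j + 1)
        * (fact (2 * j) / (2 ^ j * fact j))"
      by (simp add: divide_simps)
    moreover have "Suc k = 2 * Suc j" "k - 1 = 2 * j" "real k = 2 * real j + 1" using k by auto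
    ultimately show ?thesis
      using integral_std_normal_moment_even[of "Suc j"] integral_std_normal_moment_even[of j]
      by (simp only: eq)
  qed
qed

text \<open>Gaussian integration by parts. Both sides are linear in \<open>p\<close>, and for
  monomials this is the moment recursion. General coefficients are allowed because complex
  polynomials of a real Gaussian occur later.\<close>

lemma gauss_Stein:
  fixes p :: "'b::{real_normed_field, banach, second_countable_topology} poly"
  shows "(\<integral>x. of_real x * poly p (of_real x) \<partial>gauss) = (\<integral>x. poly (pderiv p) (of_real x) \<partial>gauss)"
proof -
  have int: "integrable gauss (\<lambda>x. of_real x * poly q (of_real x))"
            "integrable gauss (\<lambda>x. poly q (of_real x))" for q :: "'b poly"
    by (simp_all add: polygrowth_integrable all_moments_gauss polygrowth_poly polygrowth_intros)
  have int_of_real: "(\<integral>x. (of_real (x ^ j) :: 'b) \<partial>gauss) = of_real (\<integral>x. x ^ j \<partial>gauss)" for j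
    by (intro integral_bounded_linear bounded_linear_of_real polygrowth_integrable all_moments_gauss
        polygrowth_intros)
  have mono: "(\<integral>x. of_real x * poly (monom c k) (of_real x) \<partial>gauss)
      = (\<integral>x. poly (pderiv (monom c k)) (of_real x) \<partial>gauss)" for c :: 'b and k
  proof -
    have "(\<integral>x. of_real x * poly (monom c k) (of_real x) \<partial>gauss) = (\<integral>x. c * of_real (x ^ Suc k)
        \<partial>gauss)"
      by (simp add: poly_monom mult_ac)
    also have "\<dots> = c * of_real (real k * (\<integral>x. x ^ (k - 1) \<partial>gauss))"
      by (simp only: integral_mult_right_zero int_of_real gauss_moment_Suc)
    also have "\<dots> = (\<integral>x. c * of_nat k * of_real (x ^ (k - 1)) \<partial>gauss)"
      by (simp only: integral_mult_right_zero int_of_real) simp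
    also have "\<dots> = (\<integral>x. poly (pderiv (monom c k)) (of_real x) \<partial>gauss)"
      by (simp add: pderiv_monom poly_monom mult_ac)
    finally show ?thesis .
  qed
  have "(\<integral>x. of_real x * poly (\<Sum>k\<in>K. monom (coeff p k) k) (of_real x) \<partial>gauss)
      = (\<integral>x. poly (pderiv (\<Sum>k\<in>K. monom (coeff p k) k)) (of_real x) \<partial>gauss)" if "finite K" for K
    using that by induction
      (simp_all add: pderiv_add distrib_left Bochner_Integration.integral_add int mono)
  from this[of "{..degree p}"] show ?thesis
    by (simp add: poly_as_sum_of_monoms)
qed

text \<open>The Stein terms of \<open>t\<close> and \<open>\<i> * g\<close> cancel, so all positive moments of \<open>t + \<i> * g\<close> vanish.\<close>
lemma integral_gauss_circular_poly:
  "(\<integral>t. \<integral>g. poly p (complex_of_real t + \<i> * complex_of_real g) \<partial>gauss \<partial>gauss) = poly p 0"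
proof -
  define E where "E q = (\<integral>t. \<integral>g. poly q (complex_of_real t + \<i> * complex_of_real g) \<partial>gauss
      \<partial>gauss)" for q
  have pg: "polygrowth (\<lambda>x. poly q (complex_of_real (fst x) + \<i> * complex_of_real (snd x)))" for q
    by (simp add: polygrowth_poly polygrowth_intros)
  have intg: "integrable gauss (\<lambda>g. poly q (complex_of_real t + \<i> * complex_of_real g))" for q t
    by (simp add: polygrowth_integrable all_moments_gauss polygrowth_poly polygrowth_intros)
  have intt: "integrable gauss (\<lambda>t. \<integral>g. poly q (complex_of_real t + \<i> * complex_of_real g)
      \<partial>gauss)" for q
    by (intro polygrowth_integrable[OF all_moments_gauss] polygrowth_integral all_moments_gauss pg)
  have add: "E (q + r) = E q + E r" for q r
    by (simp add: E_def Bochner_Integration.integral_add intg intt)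
  have X: "E ([:0, 1:] * q) = 0" for q
  proof -
    have "E ([:0, 1:] * q) = (\<integral>t. (\<integral>g. complex_of_real t * poly q (complex_of_real t
        + \<i> * complex_of_real g) \<partial>gauss)
       + \<i> * (\<integral>g. complex_of_real g * poly q (complex_of_real t + \<i> * complex_of_real g) \<partial>gauss)
           \<partial>gauss)"
      unfolding E_def
    proof (rule Bochner_Integration.integral_cong[OF refl])
      fix t :: real
      let ?q = "\<lambda>g. poly q (complex_of_real t + \<i> * complex_of_real g)"
      have "(\<integral>g. poly ([:0, 1:] * q) (complex_of_real t + \<i> * complex_of_real g) \<partial>gauss)
          = (\<integral>g. complex_of_real t * ?q g + \<i> * (complex_of_real g * ?q g) \<partial>gauss)"
        by (simp add: algebra_simps)
      also have "\<dots> = (\<integral>g. complex_of_real t * ?q g \<partial>gauss) + (\<integral>g. \<i> * (complex_of_real g * ?q g)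
          \<partial>gauss)"
        by (rule Bochner_Integration.integral_add)
           (intro polygrowth_integrable all_moments_gauss polygrowth_intros polygrowth_poly)+
      finally show "(\<integral>g. poly ([:0, 1:] * q) (complex_of_real t + \<i> * complex_of_real g) \<partial>gauss)
          = (\<integral>g. complex_of_real t * ?q g \<partial>gauss) + \<i> * (\<integral>g. complex_of_real g * ?q g \<partial>gauss)"
        by simp
    qed
    also have "\<dots> = (\<integral>t. \<integral>g. complex_of_real t * poly q (complex_of_real t + \<i> * complex_of_real g)
        \<partial>gauss \<partial>gauss)
       + \<i> * (\<integral>t. \<integral>g. complex_of_real g * poly q (complex_of_real t + \<i> * complex_of_real g) \<partial>gauss
           \<partial>gauss)"
      by (subst Bochner_Integration.integral_add)
         (auto intro!: polygrowth_integrable all_moments_gauss polygrowth_integral polygrowth_intros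
             polygrowth_poly)
    also have "(\<integral>t. \<integral>g. complex_of_real t * poly q (complex_of_real t + \<i> * complex_of_real g)
        \<partial>gauss \<partial>gauss)
       = (\<integral>g. \<integral>t. complex_of_real t * poly q (complex_of_real t + \<i> * complex_of_real g) \<partial>gauss
           \<partial>gauss)"
      by (rule polygrowth_Fubini[OF all_moments_gauss all_moments_gauss])
         (simp add: polygrowth_poly polygrowth_intros)
    also have "\<dots> = (\<integral>g. \<integral>t. poly (pderiv q) (complex_of_real t + \<i> * complex_of_real g) \<partial>gauss
        \<partial>gauss)"
    proof (rule Bochner_Integration.integral_cong[OF refl])
      fix g :: real
      show "(\<integral>t. complex_of_real t * poly q (complex_of_real t + \<i> * complex_of_real g) \<partial>gauss)
        = (\<integral>t. poly (pderiv q) (complex_of_real t + \<i> * complex_of_real g) \<partial>gauss)"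
        using gauss_Stein[of "q \<circ>\<^sub>p [:\<i> * complex_of_real g, 1:]"]
        by (simp add: poly_pcompose pderiv_pcompose pderiv_pCons add.commute)
    qed
    also have "\<dots> = E (pderiv q)"
      unfolding E_def by (rule polygrowth_Fubini[OF all_moments_gauss
          all_moments_gauss, symmetric]) (rule pg)
    also have "(\<integral>t. \<integral>g. complex_of_real g * poly q (complex_of_real t + \<i> * complex_of_real g)
        \<partial>gauss \<partial>gauss)
       = (\<integral>t. \<integral>g. \<i> * poly (pderiv q) (complex_of_real t + \<i> * complex_of_real g) \<partial>gauss \<partial>gauss)"
    proof (rule Bochner_Integration.integral_cong[OF refl])
      fix t :: real
      show "(\<integral>g. complex_of_real g * poly q (complex_of_real t + \<i> * complex_of_real g) \<partial>gauss)
        = (\<integral>g. \<i> * poly (pderiv q) (complex_of_real t + \<i> * complex_of_real g) \<partial>gauss)"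
        \<comment> \<open>The inner affine map has slope \<open>\<i>\<close>, which combines with
          the outer factor \<open>\<i>\<close> to give the sign -1.\<close>
        using gauss_Stein[of "q \<circ>\<^sub>p [:complex_of_real t, \<i>:]"]
        by (simp add: poly_pcompose pderiv_pcompose pderiv_pCons mult.commute)
    qed
    finally show ?thesis by (simp add: E_def)
  qed
  obtain c q where p: "p = pCons c q" by (cases p) 
  have "p = [:c:] + [:0, 1:] * q" by (simp add: p)
  then have "E p = E [:c:]" by (simp only: add X add_0_right)
  then show ?thesis by (simp add: E_def p)
qed

section \<open>Mixed moments for a single column\<close>

definition mixed_moment :: "real \<Rightarrow> real \<Rightarrow> nat \<Rightarrow> nat \<Rightarrow> complex" where
  "mixed_moment s c a b =
     (\<integral>x. \<integral>y. complex_of_real (s * x) ^ a * (complex_of_real y + \<i> * complex_of_real (c * x)) ^ b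
         \<partial>gauss \<partial>gauss)"

lemma mixed_moment_scale: "mixed_moment s c a b = complex_of_real s ^ a * mixed_moment 1 c a b"
  by (simp add: mixed_moment_def power_mult_distrib mult.assoc)

text \<open>Putting \<open>x\<close> innermost allows integration by parts in
  \<open>x\<close>.\<close>

lemma mixed_moment_Fubini:
  "mixed_moment 1 c a b =
     (\<integral>y. \<integral>x. complex_of_real x ^ a * (complex_of_real y + \<i> * complex_of_real (c * x)) ^ b \<partial>gauss
         \<partial>gauss)"
  unfolding mixed_moment_def mult_1_left
  by (rule polygrowth_Fubini[OF all_moments_gauss all_moments_gauss]) (intro polygrowth_intros)

text \<open>Integration by parts in \<open>x\<close>: the derivative hits either the power of
  \<open>x\<close> or the second factor, whose inner derivative is \<open>\<i> * c\<close>.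
  Truncated exponents only occur with coefficient zero.\<close>

lemma mixed_moment_Suc_left:
  "mixed_moment 1 c (Suc a) b =
     of_nat a * mixed_moment 1 c (a - 1) b + of_nat b * (\<i> * c) * mixed_moment 1 c a (b - 1)"
proof -
  have "mixed_moment 1 c (Suc a) b = (\<integral>y. \<integral>x. complex_of_real x *
      poly (monom 1 a * [:complex_of_real y, \<i> * c:] ^ b) (complex_of_real x) \<partial>gauss \<partial>gauss)"
    unfolding mixed_moment_Fubini by (simp add: poly_monom mult_ac)
  also have "\<dots> = (\<integral>y. \<integral>x.
      poly (pderiv (monom 1 a * [:complex_of_real y, \<i> * c:] ^ b)) (complex_of_real x) \<partial>gauss
          \<partial>gauss)"
    by (simp only: gauss_Stein)
  also have "\<dots> = (\<integral>y. \<integral>x.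
      of_nat a * (complex_of_real x ^ (a - 1) * (complex_of_real y
          + \<i> * complex_of_real (c * x)) ^ b)
      + of_nat b * (\<i> * c) * (complex_of_real x ^ a * (complex_of_real y
          + \<i> * complex_of_real (c * x)) ^ (b - 1)) \<partial>gauss \<partial>gauss)"
    by (simp add: poly_monom pderiv_mult pderiv_monom pderiv_power pderiv_pCons algebra_simps)
  also have "\<dots> = of_nat a * mixed_moment 1 c (a - 1) b + of_nat b
      * (\<i> * c) * mixed_moment 1 c a (b - 1)"
    unfolding mixed_moment_Fubini integral_mult_right_zero[symmetric]
    by (subst Bochner_Integration.integral_add[symmetric]
        | intro polygrowth_integrable all_moments_gauss polygrowth_integral
            polygrowth_intros | rule refl)+
  finally show ?thesis .
qed

text \<open>One factor \<open>y + \<i> * c * x\<close> is split: its \<open>y\<close> part is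
  integrated by parts, its \<open>x\<close> part raises \<open>a\<close>.\<close>

lemma mixed_moment_Suc_right:
  "mixed_moment 1 c a (Suc b) = of_nat b * mixed_moment 1 c a (b - 1)
      + \<i> * c * mixed_moment 1 c (Suc a) b"
proof -
  let ?z = "\<lambda>x y. complex_of_real y + \<i> * complex_of_real (c * x)"
  have Stein: "(\<integral>y. complex_of_real y * ?z x y ^ b \<partial>gauss) = (\<integral>y. of_nat b * ?z x y ^ (b - 1)
      \<partial>gauss)" for x
    using gauss_Stein[of "[:\<i> * complex_of_real (c * x), 1:] ^ b"]
    by (simp add: pderiv_power pderiv_pCons add.commute)
  have "mixed_moment 1 c a (Suc b) =
      (\<integral>x. \<integral>y. complex_of_real x ^ a * (complex_of_real y * ?z x y ^ b) + \<i> * c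
          * (complex_of_real x ^ Suc a * ?z x y ^ b) \<partial>gauss \<partial>gauss)"
    by (simp add: mixed_moment_def algebra_simps)
  also have "\<dots> = (\<integral>x. \<integral>y. complex_of_real x ^ a * (complex_of_real y * ?z x y ^ b) \<partial>gauss \<partial>gauss)
      + \<i> * c * mixed_moment 1 c (Suc a) b"
    unfolding mixed_moment_def integral_mult_right_zero[symmetric] mult_1_left
    by (subst Bochner_Integration.integral_add[symmetric]
        | intro polygrowth_integrable all_moments_gauss polygrowth_integral
            polygrowth_intros | rule refl)+
  also have "(\<integral>x. \<integral>y. complex_of_real x ^ a * (complex_of_real y * ?z x y ^ b) \<partial>gauss \<partial>gauss)
      = of_nat b * mixed_moment 1 c a (b - 1)"
    by (simp only: integral_mult_right_zero Stein mixed_moment_def mult_1_left)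
       (simp only: integral_mult_right_zero[symmetric] mult_ac)
  finally show ?thesis .
qed

text \<open>The recursions in \<open>a\<close> and in \<open>b\<close> are mirror images of each other because \<open>s\<^sup>2 = 1 - c\<^sup>2\<close>.\<close>
lemma mixed_moment_sym:
  assumes sc: "s\<^sup>2 + c\<^sup>2 = 1"
  shows "mixed_moment s c a b = mixed_moment s c b a"
proof -
  let ?T = "mixed_moment s c"
  let ?s = "complex_of_real s" and ?c = "complex_of_real c"
  have sq: "?s * ?s = 1 - ?c * ?c"
    using arg_cong[OF sc, of complex_of_real] by (simp add: power2_eq_square algebra_simps)
  have left: "?T (Suc a) b = of_nat a * ?s\<^sup>2 * ?T (a - 1) b + of_nat b
      * (\<i> * ?c * ?s) * ?T a (b - 1)" for a b
    unfolding mixed_moment_scale[of s] mixed_moment_Suc_left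
    by (cases a) (simp_all add: algebra_simps power2_eq_square)
  have right: "?T a (Suc b) = of_nat b * ?s\<^sup>2 * ?T a (b - 1) + of_nat a
      * (\<i> * ?c * ?s) * ?T (a - 1) b" for a b
  proof -
    \<comment> \<open>Inserting the left recursion produces
      \<open>(\<i> * c)\<^sup>2 = - c\<^sup>2\<close>, which lowers the coefficient 1 to
      \<open>1 - c\<^sup>2\<close>, the variance of the second variable.\<close>
    have "mixed_moment 1 c a (Suc b) = of_nat b * (1 - ?c * ?c) * mixed_moment 1 c a (b - 1)
        + of_nat a * (\<i> * ?c) * mixed_moment 1 c (a - 1) b"
      unfolding mixed_moment_Suc_left mixed_moment_Suc_right by (simp add: algebra_simps)
    then show ?thesis
      unfolding mixed_moment_scale[of s] sq[symmetric]
      by (cases a) (simp_all add: algebra_simps power2_eq_square)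
  qed
  show ?thesis
  proof (induction "a + b" arbitrary: a b rule: less_induct)
    case less
    show ?case
    proof (cases a)
      case (Suc a')
      have "?T (a' - 1) b = ?T b (a' - 1)" "?T a' (b - 1) = ?T (b - 1) a'"
        using less[of "a' - 1" b] less[of a' "b - 1"] Suc by auto
      then show ?thesis unfolding Suc left right by simp
    next
      case 0
      show ?thesis
      proof (cases b)
        case (Suc b')
        have "?T 0 (b' - 1) = ?T (b' - 1) 0"
          using less[of 0 "b' - 1"] Suc 0 by auto
        then show ?thesis unfolding 0 Suc left right by simp
      qed (simp add: 0)
    qed
  qed
qed

section \<open>Even moments of the Gaussian radius in dimension \<open>n - 1\<close>\<close>

text \<open>A Gaussian vector in dimension \<open>n - 1\<close> is modelled by projecting one in
  dimension \<open>n\<close> along coordinate \<open>k\<close>.\<close>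

definition radial_moment :: "'n::finite \<Rightarrow> nat \<Rightarrow> real" where
  "radial_moment k m = (\<integral>x. norm (vec_upd k (x :: real^'n) 0) ^ m \<partial>gauss)"

text \<open>With \<open>r\<close> the squared radius, write \<open>r ^ Suc m\<close> as the sum of
  \<open>x_i * (x_i * r ^ m)\<close> and integrate by parts in each of the \<open>n - 1\<close>
  coordinates. The derivatives add up to \<open>(n - 1 + 2 * m) * r ^ m\<close>.\<close>

lemma radial_moment_Suc:
  fixes k :: "'n::finite"
  shows "radial_moment k (2 * Suc m) = (real CARD('n) - 1 + 2 * real m) * radial_moment k (2 * m)"
proof -
  define r where "r S x = (\<Sum>i\<in>S. (x $ i)\<^sup>2)" for S and x :: "real^'n"
  have norm_r: "norm (vec_upd k x 0) ^ (2 * j) = r (- {k}) x ^ j" for x :: "real^'n" and j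
  proof -
    have "(norm (vec_upd k x 0))\<^sup>2 = r (- {k}) x"
      by (simp add: norm_vec_upd) (simp add: r_def norm_vec_def L2_set_def sum_nonneg
          sum.remove[of UNIV k] Compl_eq_Diff_UNIV)
    then show ?thesis by (simp add: power_mult)
  qed
  have pgr: "polygrowth (r S)" for S
    unfolding r_def by (intro polygrowth_intros)
  have step: "(\<integral>x. (x $ i)\<^sup>2 * r (- {k}) x ^ m \<partial>gauss)
      = (\<integral>x. r (- {k}) x ^ m + 2 * real m * ((x $ i)\<^sup>2 * r (- {k}) x ^ (m - 1))
          \<partial>gauss)" if i: "i \<in> - {k}" for i
  proof -
    \<comment> \<open>The part of the squared radius that does not change when coordinate
      \<open>i\<close> is resampled.\<close>
    define c where "c = r (- {k} - {i})"
    have upd: "r (- {k}) (vec_upd i x t) = c x + t\<^sup>2" for x t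
      unfolding r_def c_def using i by (subst sum.remove[of _ i]) (auto intro!: sum.cong)
    have "(\<integral>x. (x $ i)\<^sup>2 * r (- {k}) x ^ m \<partial>gauss) = (\<integral>x. \<integral>t. t\<^sup>2 * (c x + t\<^sup>2) ^ m \<partial>gauss \<partial>gauss)"
      by (subst integral_gauss_resample[where k = i]) (simp_all add: upd pgr polygrowth_intros)
    also have "\<dots> = (\<integral>x. \<integral>t. (c x + t\<^sup>2) ^ m + 2 * real m * (t\<^sup>2 * (c x + t\<^sup>2) ^ (m - 1)) \<partial>gauss
        \<partial>gauss)"
    proof (rule Bochner_Integration.integral_cong[OF refl])
      fix x
      show "(\<integral>t. t\<^sup>2 * (c x + t\<^sup>2) ^ m \<partial>gauss) = (\<integral>t. (c x + t\<^sup>2) ^ m + 2 * real m * (t\<^sup>2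
          * (c x + t\<^sup>2) ^ (m - 1)) \<partial>gauss)"
        using gauss_Stein[of "[:0, 1:] * [:c x, 0, 1:] ^ m"]
        by (simp add: pderiv_mult pderiv_power pderiv_pCons power2_eq_square algebra_simps)
    qed
    also have "\<dots> = (\<integral>x. r (- {k}) x ^ m + 2 * real m * ((x $ i)\<^sup>2 * r (- {k}) x ^ (m - 1)) \<partial>gauss)"
      by (subst (2) integral_gauss_resample[where k = i]) (simp_all add: upd pgr polygrowth_intros)
    finally show ?thesis .
  qed
  have "radial_moment k (2 * Suc m) = (\<integral>x. (\<Sum>i\<in>- {k}. (x $ i)\<^sup>2 * r (- {k}) x ^ m)
      \<partial>(gauss :: (real^'n) measure))"
    unfolding radial_moment_def norm_r by (simp add: r_def sum_distrib_right)
  also have "\<dots> = (\<Sum>i\<in>- {k}. \<integral>x. (x $ i)\<^sup>2 * r (- {k}) x ^ m \<partial>(gauss :: (real^'n) measure))"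
    by (intro Bochner_Integration.integral_sum polygrowth_integrable all_moments_gauss
        polygrowth_intros pgr)
  also have "\<dots> = (\<Sum>i\<in>- {k}. \<integral>x. r (- {k}) x ^ m + 2 * real m * ((x $ i)\<^sup>2 * r (- {k}) x ^ (m - 1))
      \<partial>gauss)"
    by (intro sum.cong step refl)
  also have "\<dots> = (\<integral>x. (\<Sum>i\<in>- {k}. r (- {k}) x ^ m + 2 * real m * ((x $ i)\<^sup>2 * r (- {k}) x ^ (m - 1)))
      \<partial>gauss)"
    by (intro Bochner_Integration.integral_sum[symmetric] polygrowth_integrable all_moments_gauss
        polygrowth_intros pgr)
  also have "\<dots> = (\<integral>x. (real CARD('n) - 1 + 2 * real m) * r (- {k}) x ^ m \<partial>gauss)"
  proof (rule Bochner_Integration.integral_cong[OF refl])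
    fix x :: "real^'n"
    have card: "real (card (- {k})) = real CARD('n) - 1"
      by (simp add: Compl_eq_Diff_UNIV card_Diff_singleton of_nat_diff)
    have "(\<Sum>i\<in>- {k}. r (- {k}) x ^ m + 2 * real m * ((x $ i)\<^sup>2 * r (- {k}) x ^ (m - 1)))
        = real (card (- {k})) * r (- {k}) x ^ m + 2 * real m
            * (r (- {k}) x * r (- {k}) x ^ (m - 1))"
      by (simp add: sum.distrib sum_distrib_left[symmetric]
          sum_distrib_right[symmetric] flip: r_def)
    \<comment> \<open>For \<open>m = 0\<close> the truncated exponent is harmless because of the
      factor \<open>m\<close>.\<close>
    also have "2 * real m * (r (- {k}) x * r (- {k}) x ^ (m - 1)) = 2 * real m * r (- {k}) x ^ m"
      by (cases m) auto
    finally show "(\<Sum>i\<in>- {k}. r (- {k}) x ^ m + 2 * real m * ((x $ i)\<^sup>2 * r (- {k}) x ^ (m - 1)))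
        = (real CARD('n) - 1 + 2 * real m) * r (- {k}) x ^ m"
      by (simp add: card algebra_simps)
  qed
  finally show ?thesis by (simp add: radial_moment_def norm_r)
qed

lemma dfact_pos: "dfact n > 0"
  by (induction n rule: dfact.induct) auto

text \<open>The recursion factor \<open>n - 1 + 2 * j\<close> is exactly the next factor in this
  double factorial convention. The normalising constants in \<open>Phi_On\<close> are therefore
  radial moments.\<close>

lemma radial_moment_dfact:
  fixes k :: "'n::finite"
  assumes "even m" "CARD('n) \<ge> 2"
  shows "radial_moment k m = real (dfact (m + CARD('n) - 2)) / real (dfact (CARD('n) - 2))"
proof -
  obtain j where m: "m = 2 * j" using assms by blast
  define N where "N = CARD('n) - 2"
  have N: "CARD('n) = Suc (Suc N)" using assms(2) by (simp add: N_def)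
  show ?thesis unfolding m
  proof (induction j)
    case 0
    show ?case using dfact_pos[of "CARD('n) - 2"] by (simp add: radial_moment_def)
  next
    case (Suc j)
    have "dfact (2 * Suc j + CARD('n) - 2) = (2 * j + Suc N) * dfact (2 * j + CARD('n) - 2)"
      by (simp add: N)
    then show ?case
      unfolding radial_moment_Suc Suc.IH by (simp add: N algebra_simps)
  qed
qed

subsection \<open>Haar measure on the orthogonal group\<close>

lemma haar_On_prob: "haar_On M \<Longrightarrow> prob_space M"
  by (simp add: haar_On_def)

lemma haar_On_sets: "haar_On M \<Longrightarrow> sets M = sets borel"
  by (simp add: haar_On_def)

lemma haar_On_AE_orthogonal:
  assumes "haar_On M"
  shows "AE U in M. orthogonal_matrix U"
proof -
  interpret prob_space M using assms by (rule haar_On_prob)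
  have "emeasure M {U. orthogonal_matrix U} = 1" using assms by (simp add: haar_On_def)
  then have "prob {U. orthogonal_matrix U} = 1" by (simp add: measure_def)
  from AE_prob_1[OF this] show ?thesis by simp
qed

lemma norm_orthogonal_matrix_row:
  fixes U :: "real^'n^'n"
  shows "orthogonal_matrix U \<Longrightarrow> norm (U $ i) = 1"
  by (simp add: orthogonal_matrix_orthonormal_rows row_def)

text \<open>Almost surely all rows are unit vectors, so the matrix norm is bounded.\<close>

lemma all_moments_haar:
  assumes "haar_On (M :: (real^'n^'n) measure)"
  shows "all_moments M"
proof -
  interpret prob_space M using assms by (rule haar_On_prob)
  have "integrable M (\<lambda>U. norm U ^ k)" for k
  proof (rule integrable_const_bound)
    show "AE U in M. norm (norm U ^ k) \<le> real CARD('n) ^ k"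
      using haar_On_AE_orthogonal[OF assms]
    proof eventually_elim
      case (elim U)
      have "norm U \<le> (\<Sum>i\<in>UNIV. norm (U $ i))"
        unfolding norm_vec_def by (rule L2_set_le_sum) simp
      then have "norm U \<le> real CARD('n)" by (simp add: norm_orthogonal_matrix_row[OF elim])
      then show ?case by (simp add: power_mono)
    qed
    show "(\<lambda>U. norm U ^ k) \<in> borel_measurable M"
      using haar_On_sets[OF assms] by (simp cong: measurable_cong_sets)
  qed
  then show ?thesis using assms by (simp add: all_moments_def haar_On_prob haar_On_sets)
qed

lemma haar_On_invariant:
  fixes F :: "real^'n^'n \<Rightarrow> 'c::{banach, second_countable_topology}"
  assumes M: "haar_On M" and Q: "orthogonal_matrix Q" and F: "F \<in> borel_measurable borel"
  shows "(\<integral>U. F (Q ** U) \<partial>M) = (\<integral>U. F U \<partial>M)"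
proof -
  have "linear (\<lambda>U :: real^'n^'n. Q ** U)"
    by (rule linearI) (simp_all add: vec_eq_iff matrix_matrix_mult_def sum.distrib
        sum_distrib_left algebra_simps)
  then have "(\<lambda>U :: real^'n^'n. Q ** U) \<in> borel_measurable borel"
    by (intro borel_measurable_continuous_onI linear_continuous_on)
        (simp add: linear_conv_bounded_linear)
  then have meas: "(\<lambda>U. Q ** U) \<in> measurable M M" and "F \<in> borel_measurable M"
    using haar_On_sets[OF M] F by (simp_all cong: measurable_cong_sets)
  moreover have "distr M M (\<lambda>U. Q ** U) = M" using M Q by (simp add: haar_On_def)
  ultimately show ?thesis using integral_distr[OF meas, of F] by simp
qed

text \<open>The Householder reflection exchanging \<open>axis k 1\<close> and \<open>q\<close>; division by zero makes it the identity
  when they coincide.\<close>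
lemma orthogonal_matrix_with_row:
  fixes q :: "real^'n"
  assumes q: "norm q = 1"
  obtains Q :: "real^'n^'n" where "orthogonal_matrix Q" "Q $ k = q"
    "\<And>i. i \<noteq> k \<Longrightarrow> q $ i = 0 \<Longrightarrow> Q $ i = axis i 1"
proof -
  define w where "w = axis k 1 - q"
  define h where "h x = x - (2 * (w \<bullet> x) / (w \<bullet> w)) *\<^sub>R w" for x
  have h: "h x \<bullet> h y = x \<bullet> y" for x y
    by (cases "w = 0") (simp_all add: h_def inner_diff inner_commute field_simps)
  define Q :: "real^'n^'n" where "Q = (\<chi> i. h (axis i 1))"
  have Qi: "row i Q = h (axis i 1)" for i by (simp add: Q_def row_def)
  show ?thesis
  proof
    show "orthogonal_matrix Q"
      unfolding orthogonal_matrix_orthonormal_rows Qi orthogonal_def h norm_eq_1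
      by (auto simp: inner_axis_axis)
    have qq: "q \<bullet> q = 1" using q by (simp add: norm_eq_1)
    show "Q $ k = q"
    proof (cases "w = 0")
      case False
      \<comment> \<open>Both exchanged vectors have length 1, which makes the reflection coefficient
        equal to 1.\<close>
      have "w \<bullet> w = 2 * (w \<bullet> axis k 1)"
        using qq by (simp add: w_def inner_diff inner_commute inner_axis inner_axis_axis)
      moreover have "w \<bullet> w \<noteq> 0" using False by simp
      ultimately have "h (axis k 1) = axis k 1 - w"
        by (simp add: h_def)
      then show ?thesis by (simp add: Q_def w_def)
    qed (simp add: Q_def h_def, simp add: w_def)
    show "Q $ i = axis i 1" if "i \<noteq> k" "q $ i = 0" for i
    proof -
      have "w \<bullet> axis i 1 = w $ i" by (simp add: inner_axis)
      also have "\<dots> = 0" using that by (simp add: w_def axis_def)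
      finally show ?thesis by (simp add: Q_def h_def)
    qed
  qed
qed

section \<open>Rotating rows of a Haar matrix\<close>

text \<open>The combination of rows with coefficients \<open>q\<close> becomes a multiple of row
  \<open>k\<close> after a left rotation, which can keep row \<open>i\<close> fixed if
  \<open>q\<close> does not involve it. The case \<open>i = k\<close> imposes no condition.\<close>

lemma haar_rotation_exists:
  fixes q :: "real^'n"
  assumes "k \<noteq> i \<Longrightarrow> q $ i = 0"
  obtains Q :: "real^'n^'n" where "orthogonal_matrix Q"
    "\<And>U :: real^'n^'n. norm q *\<^sub>R (Q ** U) $ k = transpose U *v q"
    "\<And>U :: real^'n^'n. i \<noteq> k \<Longrightarrow> (Q ** U) $ i = U $ i"
proof -
  \<comment> \<open>For \<open>q = 0\<close> any unit vector with vanishing coordinate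
    \<open>i\<close> (when \<open>i \<noteq> k\<close>) would do.\<close>
  define u where "u = (if q = 0 then axis k 1 else q /\<^sub>R norm q)"
  have u: "norm u = 1" "q = norm q *\<^sub>R u"
    by (auto simp: u_def norm_axis_1)
  have u0: "i \<noteq> k \<Longrightarrow> u $ i = 0"
    using assms by (auto simp: u_def axis_def)
  obtain Q :: "real^'n^'n" where Q: "orthogonal_matrix Q" "Q $ k = u" "i \<noteq> k \<Longrightarrow> Q $ i = axis i 1"
    using orthogonal_matrix_with_row[OF u(1), of k] u0 by metis
  show ?thesis
  proof
    show "orthogonal_matrix Q" by fact
    fix U :: "real^'n^'n"
    have "(Q ** U) $ k = transpose U *v u"
      by (simp add: vec_eq_iff matrix_matrix_mult_def matrix_vector_mult_def transpose_def Q(2) mult.commute)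
    then show "norm q *\<^sub>R (Q ** U) $ k = transpose U *v q"
      by (subst (2) u(2)) (simp add: matrix_vector_mult_scaleR)
    show "(Q ** U) $ i = U $ i" if "i \<noteq> k"
      by (simp add: vec_eq_iff matrix_matrix_mult_def Q(3)[OF that] axis_def if_distrib[of "\<lambda>x. x * _"] cong: if_cong)
  qed
qed

text \<open>Left invariance under rotations fixing axis \<open>i\<close>: given row
  \<open>i\<close>, a combination of the other rows is distributed like row \<open>k\<close> times
  the length of the coefficient vector.\<close>

lemma haar_rotate_row_fixing:
  fixes F :: "real^'n \<Rightarrow> real^'n \<Rightarrow> 'c::{banach, second_countable_topology}"
  assumes M: "haar_On M" and F: "polygrowth (\<lambda>p. F (fst p) (snd p))" and i: "i \<noteq> k" "q $ i = 0"
  shows "(\<integral>U. F (U $ i) (transpose U *v q) \<partial>M) = (\<integral>U. F (U $ i) (norm q *\<^sub>R U $ k) \<partial>M)"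
proof -
  obtain Q :: "real^'n^'n" where Q: "orthogonal_matrix Q"
    "\<And>U :: real^'n^'n. norm q *\<^sub>R (Q ** U) $ k = transpose U *v q"
    "\<And>U :: real^'n^'n. (Q ** U) $ i = U $ i"
    using haar_rotation_exists[of k i q] i by metis
  have "polygrowth (\<lambda>U :: real^'n^'n. F (U $ i) (norm q *\<^sub>R U $ k))"
    using polygrowth_compose[OF F polygrowth_Pair[where f = "\<lambda>U. U $ i"
        and g = "\<lambda>U. norm q *\<^sub>R U $ k"]]
    by (simp add: polygrowth_intros)
  from haar_On_invariant[OF M Q(1) polygrowth_measurable[OF this]] show ?thesis
    by (simp add: Q)
qed

lemma haar_rotate_row:
  fixes F :: "real^'n \<Rightarrow> 'c::{banach, second_countable_topology}"
  assumes M: "haar_On M" and F: "polygrowth F"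
  shows "(\<integral>U. F (transpose U *v q) \<partial>M) = (\<integral>U. F (norm q *\<^sub>R U $ k) \<partial>M)"
proof -
  obtain Q :: "real^'n^'n" where Q: "orthogonal_matrix Q"
    "\<And>U :: real^'n^'n. norm q *\<^sub>R (Q ** U) $ k = transpose U *v q"
    using haar_rotation_exists[of k k q] by metis
  have "polygrowth (\<lambda>U :: real^'n^'n. F (norm q *\<^sub>R U $ k))"
    by (intro polygrowth_compose[OF F] polygrowth_intros)
  from haar_On_invariant[OF M Q(1) polygrowth_measurable[OF this]] show ?thesis
    by (simp add: Q)
qed

lemma orthogonal_transformation_transpose_mult:
  fixes U :: "real^'n^'n"
  assumes "orthogonal_matrix U"
  shows "orthogonal_transformation ((*v) (transpose U))"
  using assms by (simp add: orthogonal_transformation_matrix orthogonal_matrix_transpose)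

text \<open>Polar decomposition: radius and direction of a Gaussian vector are independent, and the
  direction is distributed as a Haar row. Average the rotated integral over \<open>U\<close>,
  exchange the integrals and use \<open>haar_rotate_row\<close> for fixed \<open>z\<close>.\<close>

lemma gauss_polar:
  fixes F :: "real^'n \<Rightarrow> 'c::{banach, second_countable_topology}"
  assumes M: "haar_On M" and F: "polygrowth F"
  shows "(\<integral>z. F z \<partial>gauss) = (\<integral>z. \<integral>U. F (norm (z :: real^'n) *\<^sub>R U $ k) \<partial>M \<partial>gauss)"
proof -
  interpret prob_space M using M by (rule haar_On_prob)
  have "(\<integral>z. F z \<partial>gauss) = (\<integral>U. \<integral>z. F z \<partial>gauss \<partial>M)"
    using prob_space by simp
  also have "\<dots> = (\<integral>U. \<integral>z. F (transpose U *v z) \<partial>gauss \<partial>M)"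
  proof (rule integral_cong_AE)
    show "AE U in M. (\<integral>z. F z \<partial>gauss) = (\<integral>z. F (transpose U *v z) \<partial>gauss)"
      using haar_On_AE_orthogonal[OF M]
    proof eventually_elim
      case (elim U)
      show ?case
        by (rule gauss_orthogonal[symmetric, OF orthogonal_transformation_transpose_mult[OF elim]
            polygrowth_measurable[OF F]])
    qed
    have "polygrowth (\<lambda>U :: real^'n^'n. \<integral>z. F (transpose U *v z) \<partial>gauss)"
      by (intro polygrowth_integral all_moments_gauss polygrowth_compose[OF F]
          polygrowth_transpose_mult polygrowth_intros)
    from polygrowth_integrable[OF all_moments_haar[OF M] this]
    show "(\<lambda>U. \<integral>z. F (transpose U *v z) \<partial>gauss) \<in> borel_measurable M" by simp
  qed simp
  also have "\<dots> = (\<integral>z. \<integral>U. F (transpose U *v z) \<partial>M \<partial>gauss)"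
    by (intro polygrowth_Fubini all_moments_gauss all_moments_haar M polygrowth_compose[OF F]
        polygrowth_transpose_mult polygrowth_intros)
  also have "\<dots> = (\<integral>z. \<integral>U. F (norm (z :: real^'n) *\<^sub>R U $ k) \<partial>M \<partial>gauss)"
    by (simp only: haar_rotate_row[OF M F, where k = k])
  finally show ?thesis .
qed


section \<open>From two Haar rows to Gaussian integrals\<close>

text \<open>Read from the right: rotate \<open>y\<close> to \<open>transpose U *v x\<close> and
  resample coordinate \<open>i\<close> of \<open>x\<close> as \<open>t\<close>. The coefficient of
  row \<open>i\<close> is then \<open>t + \<i> * g\<close>, so only the value at coefficient 0
  survives, which is the projected monomial.\<close>

lemma integral_gauss_projected_monomial:
  fixes U :: "real^'n^'n"
  assumes U: "orthogonal_matrix U"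
  shows "(\<integral>x. (\<Prod>j\<in>S. complex_of_real ((transpose U *v vec_upd i x 0) $ j) ^ b j) \<partial>gauss)
    = (\<integral>y. \<integral>g. (\<Prod>j\<in>S. (complex_of_real (y $ j) + \<i> * complex_of_real (g * U $ i $ j)) ^ b j) \<partial>gauss
        \<partial>gauss)"
proof -
  note pg = polygrowth_vec_upd polygrowth_transpose_mult[where A = "\<lambda>_. U"] polygrowth_intros
  have comp: "(transpose U *v vec_upd i x t) $ j
      = (transpose U *v vec_upd i x 0) $ j + t * U $ i $ j" for x t j
    unfolding matrix_vector_mult_def transpose_def by (simp add: sum.remove[of UNIV i])
  have "(\<integral>y. \<integral>g. (\<Prod>j\<in>S. (complex_of_real (y $ j) + \<i> * complex_of_real (g * U $ i $ j)) ^ b j)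
      \<partial>gauss \<partial>gauss)
      = (\<integral>g. \<integral>y. (\<Prod>j\<in>S. (complex_of_real (y $ j) + \<i> * complex_of_real (g * U $ i $ j)) ^ b j)
          \<partial>gauss \<partial>gauss)"
    by (rule polygrowth_Fubini[OF all_moments_gauss all_moments_gauss]) (intro pg)
  also have "\<dots> = (\<integral>g. \<integral>x. (\<Prod>j\<in>S. (complex_of_real ((transpose U *v x) $ j)
      + \<i> * complex_of_real (g * U $ i $ j)) ^ b j) \<partial>gauss \<partial>gauss)"
    by (intro Bochner_Integration.integral_cong refl
          gauss_orthogonal[symmetric, OF orthogonal_transformation_transpose_mult[OF U],
            where f = "\<lambda>y. \<Prod>j\<in>S. (complex_of_real (y $ j)
                + \<i> * complex_of_real (_ * U $ i $ j)) ^ b j"]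
          polygrowth_measurable pg)
  also have "\<dots> = (\<integral>x. \<integral>g. (\<Prod>j\<in>S. (complex_of_real ((transpose U *v x) $ j)
      + \<i> * complex_of_real (g * U $ i $ j)) ^ b j) \<partial>gauss \<partial>gauss)"
    by (rule polygrowth_Fubini[OF all_moments_gauss all_moments_gauss]) (intro pg)
  also have "\<dots> = (\<integral>x. \<integral>t. \<integral>g. (\<Prod>j\<in>S. (complex_of_real ((transpose U *v vec_upd i x t) $ j)
      + \<i> * complex_of_real (g * U $ i $ j)) ^ b j) \<partial>gauss \<partial>gauss \<partial>gauss)"
    by (rule integral_gauss_resample) (intro polygrowth_integral all_moments_gauss pg)
  also have "\<dots> = (\<integral>x. \<integral>t. \<integral>g. poly
      (\<Prod>j\<in>S. [:complex_of_real ((transpose U *v vec_upd i x 0) $ j), complex_of_real (U $ i $ j):] ^ b j)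
        (complex_of_real t + \<i> * complex_of_real g) \<partial>gauss \<partial>gauss \<partial>gauss)"
  proof -
    have "(\<Prod>j\<in>S. (complex_of_real ((transpose U *v vec_upd i x t) $ j)
        + \<i> * complex_of_real (g * U $ i $ j)) ^ b j)
      = poly
          (\<Prod>j\<in>S. [:complex_of_real ((transpose U *v vec_upd i x 0) $ j), complex_of_real (U $ i $ j):] ^ b j)
        (complex_of_real t + \<i> * complex_of_real g)" for x t g
      unfolding comp[of x t] by (simp add: poly_prod algebra_simps)
    then show ?thesis by (simp only:)
  qed
  also have "\<dots> = (\<integral>x. (\<Prod>j\<in>S. complex_of_real ((transpose U *v vec_upd i x 0) $ j) ^ b j) \<partial>gauss)"
    by (simp only: integral_gauss_circular_poly) (simp add: poly_prod)
  finally show ?thesis ..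
qed

text \<open>The integrand is homogeneous in row \<open>k\<close>, so the radial moment turns this
  row into a Gaussian vector on the orthogonal complement of row \<open>i\<close>, to which the
  previous identity applies.\<close>

lemma haar_two_rows_half:
  fixes M :: "(real^'n^'n) measure"
  assumes M: "haar_On M" and ik: "i \<noteq> k"
  shows "complex_of_real (radial_moment i (\<Sum>j\<in>S. b j) * (\<integral>U.
      (\<Prod>j\<in>S. U $ i $ j ^ a j * U $ k $ j ^ b j) \<partial>M))
    = (\<integral>U. \<integral>y. \<integral>g. (\<Prod>j\<in>S. complex_of_real (U $ i $ j) ^ a j * (complex_of_real (y $ j)
        + \<i> * complex_of_real (g * U $ i $ j)) ^ b j)
        \<partial>gauss \<partial>(gauss :: (real^'n) measure) \<partial>M)"
proof -
  note mom = all_moments_gauss all_moments_haar[OF M]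
  note pg = polygrowth_vec_upd polygrowth_transpose_mult polygrowth_intros
  have "complex_of_real (radial_moment i (\<Sum>j\<in>S. b j) * (\<integral>U.
      (\<Prod>j\<in>S. U $ i $ j ^ a j * U $ k $ j ^ b j) \<partial>M))
      = (\<integral>x. \<integral>U.
          (\<Prod>j\<in>S. complex_of_real (U $ i $ j) ^ a j * complex_of_real ((norm (vec_upd i x 0) *\<^sub>R U $ k) $ j) ^ b j) \<partial>M \<partial>gauss)"
  proof -
    have "(\<Prod>j\<in>S. complex_of_real (U $ i $ j) ^ a j * complex_of_real ((norm (vec_upd i x 0) *\<^sub>R U $ k) $ j) ^ b j)
        = complex_of_real (norm (vec_upd i x 0) ^ (\<Sum>j\<in>S. b j) *
            (\<Prod>j\<in>S. U $ i $ j ^ a j * U $ k $ j ^ b j))" for x and U :: "real^'n^'n"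
      by (simp add: power_mult_distrib prod.distrib power_sum mult_ac)
    then show ?thesis
      by (simp only: radial_moment_def of_real_mult integral_mult_right_zero integral_mult_left_zero
          integral_complex_of_real)
  qed
  \<comment> \<open>The projected \<open>x\<close> has coordinate \<open>i\<close> equal to 0, as
    needed to rotate while keeping row \<open>i\<close>.\<close>
  also have "\<dots> = (\<integral>x. \<integral>U.
      (\<Prod>j\<in>S. complex_of_real (U $ i $ j) ^ a j * complex_of_real ((transpose U *v vec_upd i x 0) $ j) ^ b j) \<partial>M \<partial>gauss)"
    by (intro Bochner_Integration.integral_cong refl
        haar_rotate_row_fixing[OF M _ ik, symmetric,
          where F = "\<lambda>u v. \<Prod>j\<in>S. complex_of_real (u $ j) ^ a j * complex_of_real (v $ j) ^ b j"] pg) simp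
  also have "\<dots> = (\<integral>U. \<integral>x.
      (\<Prod>j\<in>S. complex_of_real (U $ i $ j) ^ a j * complex_of_real ((transpose U *v vec_upd i x 0) $ j) ^ b j) \<partial>gauss \<partial>M)"
    by (rule polygrowth_Fubini[OF mom]) (intro pg)
  also have "\<dots> = (\<integral>U. \<integral>y. \<integral>g. (\<Prod>j\<in>S. complex_of_real (U $ i $ j) ^ a j * (complex_of_real (y $ j)
      + \<i> * complex_of_real (g * U $ i $ j)) ^ b j)
        \<partial>gauss \<partial>(gauss :: (real^'n) measure) \<partial>M)"
  proof (rule integral_cong_AE)
    show "AE U in M. (\<integral>x.
        (\<Prod>j\<in>S. complex_of_real (U $ i $ j) ^ a j * complex_of_real ((transpose U *v vec_upd i x 0) $ j) ^ b j) \<partial>gauss)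
      = (\<integral>y. \<integral>g. (\<Prod>j\<in>S. complex_of_real (U $ i $ j) ^ a j * (complex_of_real (y $ j)
          + \<i> * complex_of_real (g * U $ i $ j)) ^ b j)
        \<partial>gauss \<partial>(gauss :: (real^'n) measure))"
      using haar_On_AE_orthogonal[OF M]
    proof eventually_elim
      case (elim U)
      show ?case
        by (simp only: prod.distrib integral_mult_right_zero integral_gauss_projected_monomial[OF elim])
    qed
  qed (intro borel_measurable_integrable polygrowth_integrable polygrowth_integral mom pg)+
  finally show ?thesis .
qed

lemma haar_two_rows_moment:
  fixes M :: "(real^'n^'n) measure"
  assumes M: "haar_On M" and ik: "i \<noteq> k"
  shows "complex_of_real (radial_moment i (\<Sum>j\<in>S. a j) * radial_moment i (\<Sum>j\<in>S. b j)
      * (\<integral>U. (\<Prod>j\<in>S. U $ i $ j ^ a j * U $ k $ j ^ b j) \<partial>M))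
    = (\<integral>V. (\<Prod>j\<in>S. mixed_moment (norm (vec_upd i (V $ i) 0)) (V $ i $ i) (a j) (b j)) \<partial>M)"
proof -
  note mg = all_moments_gauss and mM = all_moments_haar[OF M]
  \<comment> \<open>The vector \<open>v\<close> combines two data: its projection gives the radial
    factor of the first row, and its coordinate \<open>i\<close> is the imaginary Gaussian
    \<open>g\<close>.\<close>
  define G where "G v u y = (\<Prod>j\<in>S. complex_of_real (norm (vec_upd i v 0) * u $ j) ^ a j *
      (complex_of_real (y $ j) + \<i> * complex_of_real (v $ i * u $ j)) ^ b j)" for v u y :: "real^'n"
  have pgG: "polygrowth (\<lambda>x. G (f x) (g x) (h x))"
    if "polygrowth f" "polygrowth g" "polygrowth h" for f g h :: "'a::euclidean_space \<Rightarrow> real^'n"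
    unfolding G_def by (intro polygrowth_vec_upd polygrowth_intros that)
  note pg = pgG polygrowth_integral mg mM polygrowth_intros
  \<comment> \<open>In \<open>G\<close> the vector \<open>v\<close> enters through two quantities
    homogeneous of degree 1, each multiplied by a coordinate of \<open>u\<close>; hence a
    nonnegative scalar can move from \<open>v\<close> to \<open>u\<close>.\<close>
  have G_scale: "G (r *\<^sub>R v) u y = G v (r *\<^sub>R u) y" if "r \<ge> 0" for r v u y
  proof -
    have "vec_upd i (r *\<^sub>R v) 0 = r *\<^sub>R vec_upd i v 0"
      by (simp add: vec_eq_iff)
    then show ?thesis using that by (simp add: G_def mult_ac)
  qed
  have "complex_of_real (radial_moment i (\<Sum>j\<in>S. a j) * radial_moment i (\<Sum>j\<in>S. b j)
      * (\<integral>U. (\<Prod>j\<in>S. U $ i $ j ^ a j * U $ k $ j ^ b j) \<partial>M))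
    = complex_of_real (radial_moment i (\<Sum>j\<in>S. a j)) * (\<integral>U. \<integral>y. \<integral>g.
        (\<Prod>j\<in>S. complex_of_real (U $ i $ j) ^ a j * (complex_of_real (y $ j)
        + \<i> * complex_of_real (g * U $ i $ j)) ^ b j)
        \<partial>gauss \<partial>(gauss :: (real^'n) measure) \<partial>M)"
    unfolding haar_two_rows_half[OF M ik, symmetric] by simp
  also have "\<dots> = (\<integral>U. \<integral>y. \<integral>z. G z (U $ i) y \<partial>gauss \<partial>gauss \<partial>M)"
  proof -
    have "complex_of_real (radial_moment i (\<Sum>j\<in>S. a j)) * (\<integral>g. (\<Prod>j\<in>S. complex_of_real (u $ j) ^ a j
        * (complex_of_real (y $ j) + \<i> * complex_of_real (g * u $ j)) ^ b j) \<partial>gauss)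
      = (\<integral>z. G z u y \<partial>gauss)" for u y
    proof -
      \<comment> \<open>Resampling separates coordinate \<open>i\<close> of \<open>z\<close>, which
        becomes \<open>g\<close>, from the projection, which yields the radial moment.\<close>
      have "(\<integral>z. G z u y \<partial>gauss) = (\<integral>z. \<integral>t. G (vec_upd i z t) u y \<partial>gauss \<partial>gauss)"
        by (rule integral_gauss_resample) (intro pg)
      also have "\<dots> = (\<integral>z. \<integral>t. complex_of_real (norm (vec_upd i z 0) ^ (\<Sum>j\<in>S. a j)) *
          (\<Prod>j\<in>S. complex_of_real (u $ j) ^ a j * (complex_of_real (y $ j)
              + \<i> * complex_of_real (t * u $ j)) ^ b j) \<partial>gauss \<partial>gauss)"
      proof -
        have "vec_upd i (vec_upd i z t) 0 = vec_upd i z 0" for z :: "real^'n" and t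
          by (simp add: vec_eq_iff)
        then show ?thesis
          by (simp add: G_def power_mult_distrib prod.distrib power_sum mult_ac)
      qed
      also have "\<dots> = complex_of_real (radial_moment i (\<Sum>j\<in>S. a j)) * (\<integral>g.
          (\<Prod>j\<in>S. complex_of_real (u $ j) ^ a j * (complex_of_real (y $ j)
          + \<i> * complex_of_real (g * u $ j)) ^ b j) \<partial>gauss)"
        by (simp only: integral_mult_right_zero integral_mult_left_zero radial_moment_def integral_complex_of_real)
      finally show ?thesis ..
    qed
    then show ?thesis by (simp only: integral_mult_right_zero[symmetric])
  qed
  \<comment> \<open>The direction of \<open>z\<close> becomes row \<open>i\<close> of a second Haar
    matrix \<open>V\<close>, and its norm is transferred to \<open>U $ i\<close>.\<close>
  also have "\<dots> = (\<integral>U. \<integral>y. \<integral>z. \<integral>V. G (V $ i) (norm (z :: real^'n) *\<^sub>R U $ i) y \<partial>M \<partial>gauss \<partial>gauss \<partial>M)"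
  proof -
    have "(\<integral>z. G z u y \<partial>gauss) = (\<integral>z. \<integral>V. G (V $ i) (norm (z :: real^'n) *\<^sub>R u) y \<partial>M
        \<partial>gauss)" for u y
      using gauss_polar[OF M, of "\<lambda>z. G z u y" i] by (simp add: G_scale pgG polygrowth_intros)
    then show ?thesis by simp
  qed
  \<comment> \<open>The following exchanges bring \<open>V\<close> outside, so that
    \<open>norm z\<close> and \<open>U\<close> stand together inside.\<close>
  also have "\<dots> = (\<integral>y. \<integral>U. \<integral>z. \<integral>V. G (V $ i) (norm (z :: real^'n) *\<^sub>R U $ i) y \<partial>M \<partial>gauss \<partial>M \<partial>gauss)"
    by (rule polygrowth_Fubini[OF mM mg]) (intro pg)
  also have "\<dots> = (\<integral>y. \<integral>V. \<integral>z. \<integral>U. G (V $ i) (norm (z :: real^'n) *\<^sub>R U $ i) y \<partial>M \<partial>gauss \<partial>M \<partial>gauss)"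
  proof (rule Bochner_Integration.integral_cong[OF refl])
    fix y
    have "(\<integral>U. \<integral>z. \<integral>V. G (V $ i) (norm (z :: real^'n) *\<^sub>R U $ i) y \<partial>M \<partial>gauss \<partial>M)
        = (\<integral>z. \<integral>U. \<integral>V. G (V $ i) (norm (z :: real^'n) *\<^sub>R U $ i) y \<partial>M \<partial>M \<partial>gauss)"
      by (rule polygrowth_Fubini[OF mM mg]) (intro pg)
    also have "\<dots> = (\<integral>z. \<integral>V. \<integral>U. G (V $ i) (norm (z :: real^'n) *\<^sub>R U $ i) y \<partial>M \<partial>M \<partial>gauss)"
      by (intro Bochner_Integration.integral_cong refl polygrowth_Fubini[OF mM mM] pg)
    also have "\<dots> = (\<integral>V. \<integral>z. \<integral>U. G (V $ i) (norm (z :: real^'n) *\<^sub>R U $ i) y \<partial>M \<partial>gauss \<partial>M)"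
      by (rule polygrowth_Fubini[OF mg mM]) (intro pg)
    finally show "(\<integral>U. \<integral>z. \<integral>V. G (V $ i) (norm (z :: real^'n) *\<^sub>R U $ i) y \<partial>M \<partial>gauss \<partial>M)
        = (\<integral>V. \<integral>z. \<integral>U. G (V $ i) (norm (z :: real^'n) *\<^sub>R U $ i) y \<partial>M \<partial>gauss \<partial>M)" .
  qed
  \<comment> \<open>The polar decomposition is used backwards: \<open>norm z\<close> times the row
    of \<open>U\<close> is a Gaussian vector \<open>x\<close>.\<close>
  also have "\<dots> = (\<integral>y. \<integral>V. \<integral>x. G (V $ i) x y \<partial>gauss \<partial>M \<partial>gauss)"
  proof -
    have "(\<integral>x. G v x y \<partial>gauss) = (\<integral>z. \<integral>U. G v (norm (z :: real^'n) *\<^sub>R U $ i) y \<partial>M \<partial>gauss)" for v y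
      by (rule gauss_polar[OF M]) (intro pg)
    then show ?thesis by simp
  qed
  also have "\<dots> = (\<integral>V. \<integral>y. \<integral>x. G (V $ i) x y \<partial>gauss \<partial>gauss \<partial>M)"
    by (rule polygrowth_Fubini[OF mg mM]) (intro pg)
  also have "\<dots> = (\<integral>V. \<integral>x. \<integral>y. G (V $ i) x y \<partial>gauss \<partial>gauss \<partial>M)"
    by (intro Bochner_Integration.integral_cong refl polygrowth_Fubini[OF mg mg] pg)
  also have "\<dots> = (\<integral>V. (\<Prod>j\<in>S. mixed_moment (norm (vec_upd i (V $ i) 0)) (V $ i $ i) (a j) (b j)) \<partial>M)"
  proof (rule Bochner_Integration.integral_cong[OF refl])
    fix V :: "real^'n^'n"
    let ?s = "norm (vec_upd i (V $ i) 0)" and ?c = "V $ i $ i"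
    \<comment> \<open>For fixed \<open>V\<close> the columns are independent, first in
      \<open>y\<close> and then in \<open>x\<close>.\<close>
    have "(\<integral>y. G (V $ i) x y \<partial>gauss) = (\<Prod>j\<in>S. \<integral>t. complex_of_real (?s * x $ j) ^ a j *
      (complex_of_real t + \<i> * complex_of_real (?c * x $ j)) ^ b j \<partial>gauss)" for x
      unfolding G_def
      by (rule integral_gauss_prod[where h = "\<lambda>j t. complex_of_real (?s * x $ j) ^ a j *
      (complex_of_real t + \<i> * complex_of_real (?c * x $ j)) ^ b j"]) (intro polygrowth_intros)
    then have "(\<integral>x. \<integral>y. G (V $ i) x y \<partial>gauss \<partial>gauss) = (\<integral>x.
        (\<Prod>j\<in>S. \<integral>t. complex_of_real (?s * x $ j) ^ a j *
      (complex_of_real t + \<i> * complex_of_real (?c * x $ j)) ^ b j \<partial>gauss) \<partial>gauss)"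
      by simp
    also have "\<dots> = (\<Prod>j\<in>S. mixed_moment ?s ?c (a j) (b j))"
      unfolding mixed_moment_def
      by (rule integral_gauss_prod[where h = "\<lambda>j x. \<integral>t. complex_of_real (?s * x) ^ a j *
      (complex_of_real t + \<i> * complex_of_real (?c * x)) ^ b j \<partial>gauss"])
         (intro polygrowth_integral mg polygrowth_intros)
    finally show "(\<integral>x. \<integral>y. G (V $ i) x y \<partial>gauss \<partial>gauss) = (\<Prod>j\<in>S. mixed_moment ?s ?c (a j) (b j))" .
  qed
  finally show ?thesis .
qed

section \<open>Columnwise formula and exchange of exponents\<close>

text \<open>Evenness of all exponents makes both exponent sums even, so the double factorial
  quotients are radial moments and the two-row formula applies.\<close>

lemma Phi_On_eq_mixed_moments:
  fixes M :: "(real^'n^'n) measure" and e :: "nat \<Rightarrow> 'n"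
  assumes M: "haar_On M" and e: "bij_betw e {..<CARD('n)} UNIV" and n: "CARD('n) \<ge> 2" "m \<le> CARD('n)"
    and even: "\<And>j. j < m \<Longrightarrow> even (a j) \<and> even (b j)"
  shows "complex_of_real (Phi_On M e m a b) =
    (\<integral>V. (\<Prod>j<m. mixed_moment (norm (vec_upd (e 0) (V $ e 0) 0)) (V $ e 0 $ e 0) (a j) (b j)) \<partial>M)
    / complex_of_real (\<Prod>j<m. real (dfact (a j)) * real (dfact (b j)))"
proof -
  have inj: "inj_on e {..<CARD('n)}" using e by (rule bij_betw_imp_inj_on)
  have injm: "inj_on e {..<m}" by (rule inj_on_subset[OF inj]) (use n in auto)
  have ne: "e 0 \<noteq> e 1"
    using inj_on_contraD[OF inj, of 0 1] n by auto
  \<comment> \<open>The two-row formula indexes exponents by matrix columns; \<open>inv\<close>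
    carries them over from positions \<open>j < m\<close>.\<close>
  define inv where "inv = the_inv_into {..<m} e"
  have inv: "inv (e j) = j" if "j < m" for j
    using the_inv_into_f_f[OF injm] that by (simp add: inv_def)
  have ev: "even (\<Sum>j<m. a j)" "even (\<Sum>j<m. b j)"
    using even by (auto intro!: dvd_sum)
  have "Phi_On M e m a b = radial_moment (e 0) (\<Sum>j<m. a j) * radial_moment (e 0) (\<Sum>j<m. b j)
      * I_On M e m a b / (\<Prod>j<m. real (dfact (a j)) * real (dfact (b j)))"
    unfolding Phi_On_def radial_moment_dfact[OF ev(1) n(1)] radial_moment_dfact[OF ev(2) n(1)]
    by (simp add: prod.distrib power2_eq_square)
  moreover have "complex_of_real (radial_moment (e 0) (\<Sum>j<m. a j) * radial_moment (e 0) (\<Sum>j<m. b j) * I_On M e m a b)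
    = (\<integral>V. (\<Prod>j<m. mixed_moment (norm (vec_upd (e 0) (V $ e 0) 0)) (V $ e 0 $ e 0) (a j) (b j)) \<partial>M)"
    using haar_two_rows_moment[OF M ne, where S = "e ` {..<m}" and a = "\<lambda>x. a (inv x)"
        and b = "\<lambda>x. b (inv x)"]
    by (simp add: sum.reindex prod.reindex injm inv I_On_def)
  ultimately show ?thesis by simp
qed

theorem theorem5p3:
  fixes M :: "(real^'n^'n) measure" and e :: "nat \<Rightarrow> 'n"
    and p q :: nat and a b c d :: "nat \<Rightarrow> nat"
  assumes "haar_On M"
    and "bij_betw e {..<CARD('n)} UNIV"
    and "CARD('n) \<ge> 2" and "CARD('n) \<ge> p + q"
    and "\<forall>j<p. even (a j) \<and> even (b j)"
    and "\<forall>j<q. even (c j) \<and> even (d j)"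
  shows "Phi_On M e (p + q) (catv p a c) (catv p b d)
       = Phi_On M e (p + q) (catv p a d) (catv p b c)"
proof -
  let ?ac = "catv p a c" and ?bd = "catv p b d" and ?ad = "catv p a d" and ?bc = "catv p b c"
  \<comment> \<open>Columns below \<open>p\<close> keep their exponents, the remaining ones have the
    two exponents exchanged.\<close>
  have swap: "?ac j = ?ad j \<and> ?bd j = ?bc j \<or> ?ac j = ?bc j \<and> ?bd j = ?ad j" for j
    by (simp add: catv_def)
  have even: "even (?ac j) \<and> even (?bd j)" "even (?ad j) \<and> even (?bc j)" if "j < p + q" for j
    using assms(5,6) that by (auto simp: catv_def)
  let ?P = "\<lambda>V :: real^'n^'n. \<lambda>f g. \<Prod>j<p + q. mixed_moment (norm (vec_upd (e 0) (V $ e 0) 0)) (V $ e 0 $ e 0) (f j) (g j)"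
  have pg: "polygrowth (\<lambda>V. ?P V f g)" for f g :: "nat \<Rightarrow> nat"
    unfolding mixed_moment_def
    by (intro polygrowth_integral all_moments_gauss polygrowth_vec_upd polygrowth_intros)
  have "(\<integral>V. ?P V ?ac ?bd \<partial>M) = (\<integral>V. ?P V ?ad ?bc \<partial>M)"
  proof (rule integral_cong_AE)
    show "AE V in M. ?P V ?ac ?bd = ?P V ?ad ?bc"
      using haar_On_AE_orthogonal[OF assms(1)]
    proof eventually_elim
      case (elim V)
      \<comment> \<open>The row is a unit vector almost surely, which is the variance condition for
        the symmetry in each column.\<close>
      have "(norm (vec_upd (e 0) (V $ e 0) 0))\<^sup>2 + (V $ e 0 $ e 0)\<^sup>2 = 1"
        by (simp add: norm_vec_upd norm_orthogonal_matrix_row[OF elim])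
      from mixed_moment_sym[OF this] show ?case
        using swap by (intro prod.cong refl) metis
    qed
  qed (intro borel_measurable_integrable polygrowth_integrable[OF
      all_moments_haar[OF assms(1)]] pg)+
  moreover have "(\<Prod>j<p + q. real (dfact (?ac j)) * real (dfact (?bd j)))
      = (\<Prod>j<p + q. real (dfact (?ad j)) * real (dfact (?bc j)))"
    using swap by (intro prod.cong refl) (metis mult.commute)
  ultimately have "complex_of_real (Phi_On M e (p + q) ?ac ?bd)
      = complex_of_real (Phi_On M e (p + q) ?ad ?bc)"
    using Phi_On_eq_mixed_moments[OF assms(1-4), of ?ac ?bd] Phi_On_eq_mixed_moments[OF assms(1-4), of ?ad ?bc] even
    by simp
  then show ?thesis by (simp only: of_real_eq_iff)
qed

end
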